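(* Consider the linear extended bifactor model and let $(A,\mathbf d,\Sigma_G,\boldsymbol\lambda)\in\mathfrak P$. The model is identifiable at $(A,\mathbf d,\Sigma_G,\boldsymbol\lambda)$ if at least one of the following two conditions holds: (E1S) $|\mathcal Q_g|\ge 3$ for all $g=1,\dots,G$, and $|\mathcal H_3|\ge 3$; (E2S) $|\mathcal Q_g|\ge 3$ for all $g=1,\dots,G$, $|\mathcal H_3|=2$, and $|\mathcal H_2|\ge 1$.
   Context: Linear extended bifactor model. Fix $G\ge 1$ and items $\{1,\dots,J\}$ with a fixed known partition into $G$ nonempty testlets $\mathcal B_1,\dots,\mathcal B_G$; $g_j$ is the testlet containing item $j$. Parameters: a real $J\times(1+G)$ loading matrix $A=[\mathbf a_0,\mathbf a_1,\dots,\mathbf a_G]$ with $\mathbf a_g[j]=0$ whenever $g\ge1$ and $g\ne g_j$ (the other entries are arbitrary reals, possibly zero); intercepts $\mathbf d\in\mathbb R^J$; a $G\times G$ symmetric positive definite matrix $\Sigma_G$ with all diagonal entries equal to 1; unique variances $\boldsymbol\lambda=(\lambda_1,\dots,\lambda_J)$ with $\lambda_j>0$. The observed vector $(Y_1,\dots,Y_J)$ is $$Y_j=d_j+\mathbf a_0[j]\,\eta_0+\mathbf a_{g_j}[j]\,\eta_{g_j}+\epsilon_j,$$ where $\boldsymbol\eta=(\eta_0,\eta_1,\dots,\eta_G)^T\sim N(\mathbf 0,\Sigma)$ with $\Sigma=\begin{pmatrix}1&\mathbf 0^T\\ \mathbf 0&\Sigma_G\end{pmatrix}$, and the $\epsilon_j\sim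 N(0,\lambda_j)$ are independent of each other and of $\boldsymbol\eta$. The parameter space $\mathfrak P$ is the set of all such $(A,\mathbf d,\Sigma_G,\boldsymbol\lambda)$ for which the first nonzero entry of every column of $A$ is positive (no requirement on a zero column). The model is identifiable at $(A,\mathbf d,\Sigma_G,\boldsymbol\lambda)\in\mathfrak P$ if every $(A',\mathbf d',\Sigma_G',\boldsymbol\lambda')\in\mathfrak P$ that defines the same distribution of $(Y_1,\dots,Y_J)$ equals $(A,\mathbf d,\Sigma_G,\boldsymbol\lambda)$. Notation: $x[\mathcal B]$ is the subvector of $x$ with entries in $\mathcal B$; $M[\mathcal B,:]$ is the submatrix of rows indexed by $\mathcal B$; $\bar A_g=(\mathbf a_0[\mathcal B_g],\mathbf a_g[\mathcal B_g])$ is the $|\mathcal B_g|\times 2$ matrix of main and testlet loadings of testlet $g$ (rows indexed by $\mathcal B_g$). - $\mathcal Q_g=\{j:\mathbf a_g[j]\ne 0\}$ for $g=1,\dots,G$. - $\mathcal H_2$ is the set of $g\in\{1,\dots,G\}$ for which there is a partition $\mathcal B_g=\mathcal B_{g,1}\cup\mathcal B_{g,2}$, $\mathcal B_{g,1}\cap\mathcal B_{g,2}=\emptyset$, such that both $\bar A_g[\mathcal B_{g,1},:]$ and $\bar A_g[\mathcal B_{g,2},:]$ have full column rank (rank 2). - $\mathcal H_3=\{g\in\{1,\dots,G\}:\bar A_g\text{ has column rank }2\}$. *)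

theory Defs
  imports "HOL-Probability.Probability"
begin

text \<open>
  Items are the elements of a finite linearly ordered type \<open>'j\<close> (playing the role of
  \<open>{1,...,J}\<close> with its natural order), testlets the elements of a finite type \<open>'g\<close>.
  The partition of the items is given by the map \<open>\<tau> :: 'j \<Rightarrow> 'g\<close> sending an item to its
  testlet; all testlets are nonempty iff \<open>\<tau>\<close> is surjective.  The factors, and hence the
  columns of the loading matrix, are indexed by \<open>'g option\<close>: \<open>None\<close> is the main factor and
  \<open>Some g\<close> is the factor of testlet \<open>g\<close>.  A parameter is a tuple consisting of the loading
  matrix, the intercepts, the covariance matrix of the testlet factors and the unique variances.
\<close>

type_synonym ('j, 'g) params =
  "(real ^ ('g option) ^ 'j) \<times> (real ^ 'j) \<times> (real ^ 'g ^ 'g) \<times> (real ^ 'j)"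

definition testlet :: "('j \<Rightarrow> 'g) \<Rightarrow> 'g \<Rightarrow> 'j set" where
  "testlet \<tau> g = {j. \<tau> j = g}"

definition sym_pos_def :: "real ^ 'n ^ 'n \<Rightarrow> bool" where
  "sym_pos_def S \<longleftrightarrow> transpose S = S \<and> (\<forall>x. x \<noteq> 0 \<longrightarrow> x \<bullet> (S *v x) > 0)"

definition param_space :: "('j::{finite,linorder} \<Rightarrow> 'g::finite) \<Rightarrow> ('j, 'g) params set" where
  "param_space \<tau> = {(A, d, S, l).
     (\<forall>j g. g \<noteq> \<tau> j \<longrightarrow> A $ j $ Some g = 0) \<and>
     sym_pos_def S \<and> (\<forall>g. S $ g $ g = 1) \<and>
     (\<forall>j. l $ j > 0) \<and>
     (\<forall>k j. A $ j $ k \<noteq> 0 \<and> (\<forall>i<j. A $ i $ k = 0) \<longrightarrow> A $ j $ k > 0)}"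


text \<open>The block diagonal covariance matrix of all factors, with blocks \<open>1\<close> and \<open>S\<close>.\<close>

definition factor_cov :: "real ^ 'g ^ 'g \<Rightarrow> real ^ ('g::finite option) ^ ('g option)" where
  "factor_cov S = (\<chi> k l. case (k, l) of
       (None, None) \<Rightarrow> 1
     | (Some g, Some h) \<Rightarrow> S $ g $ h
     | _ \<Rightarrow> 0)"

text \<open>
  The centred multivariate normal distribution with covariance matrix \<open>S\<close>, given by its
  Lebesgue density; it is only used for symmetric positive definite \<open>S\<close>.
\<close>

definition mvn_density :: "real ^ 'n ^ 'n \<Rightarrow> real ^ 'n \<Rightarrow> real" where
  "mvn_density S x =
     exp (- (x \<bullet> (matrix_inv S *v x)) / 2) / sqrt ((2 * pi) ^ CARD('n) * det S)"

definition mvn :: "real ^ 'n ^ 'n \<Rightarrow> (real ^ 'n) measure" where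
  "mvn S = density lborel (\<lambda>x. ennreal (mvn_density S x))"

text \<open>
  The univariate normal distribution is parametrised in the library by its standard
  deviation, so the variance \<open>l $ j\<close> enters through its square root.
\<close>

definition noise_law :: "real ^ 'j \<Rightarrow> ('j \<Rightarrow> real) measure" where
  "noise_law l = (\<Pi>\<^sub>M j\<in>UNIV. density lborel (\<lambda>x. ennreal (normal_density 0 (sqrt (l $ j)) x)))"

definition response ::
    "('j::finite \<Rightarrow> 'g::finite) \<Rightarrow> real ^ ('g option) ^ 'j \<Rightarrow> real ^ 'j \<Rightarrow>
     real ^ ('g option) \<Rightarrow> ('j \<Rightarrow> real) \<Rightarrow> real ^ 'j" where
  "response \<tau> A d \<eta> \<epsilon> =
     (\<chi> j. d $ j + A $ j $ None * \<eta> $ None + A $ j $ Some (\<tau> j) * \<eta> $ Some (\<tau> j) + \<epsilon> j)"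

text \<open>
  The distribution of the observed vector: the image under \<open>response\<close> of the joint law of
  independent factors and errors.
\<close>

definition observed_law ::
    "('j::finite \<Rightarrow> 'g::finite) \<Rightarrow> ('j, 'g) params \<Rightarrow> (real ^ 'j) measure" where
  "observed_law \<tau> = (\<lambda>(A, d, S, l).
     distr (mvn (factor_cov S) \<Otimes>\<^sub>M noise_law l) borel (\<lambda>(\<eta>, \<epsilon>). response \<tau> A d \<eta> \<epsilon>))"

definition identifiable_at ::
    "('j::{finite,linorder} \<Rightarrow> 'g::finite) \<Rightarrow> ('j, 'g) params \<Rightarrow> bool" where
  "identifiable_at \<tau> P \<longleftrightarrow>
     (\<forall>P' \<in> param_space \<tau>. observed_law \<tau> P' = observed_law \<tau> P \<longrightarrow> P' = P)"


lemma sets_noise_law: "sets (noise_law l) = sets (\<Pi>\<^sub>M j\<in>UNIV. borel)"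
  unfolding noise_law_def by (intro sets_PiM_cong) auto

lemma measurable_response:
  fixes \<tau> :: "'j::finite \<Rightarrow> 'g::finite"
  shows "(\<lambda>(\<eta>, \<epsilon>). response \<tau> A d \<eta> \<epsilon>) \<in> borel \<Otimes>\<^sub>M (\<Pi>\<^sub>M j\<in>UNIV. borel) \<rightarrow>\<^sub>M borel"
proof (subst borel_measurable_euclidean_space, intro ballI)
  fix i :: "real ^ 'j" assume "i \<in> Basis"
  then obtain j where i: "i = axis j 1"
    by (auto simp: Basis_vec_def)
  have [measurable]: "(\<lambda>x :: real ^ ('g option). x $ k) \<in> borel_measurable borel" for k
    by (intro borel_measurable_continuous_onI continuous_intros)
  have [measurable]: "(\<lambda>\<epsilon> :: 'j \<Rightarrow> real. \<epsilon> j) \<in> borel_measurable (\<Pi>\<^sub>M j\<in>UNIV. borel)"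
    by (rule measurable_component_singleton) simp
  show "(\<lambda>x. (case x of (\<eta>, \<epsilon>) \<Rightarrow> response \<tau> A d \<eta> \<epsilon>) \<bullet> i)
      \<in> borel_measurable (borel \<Otimes>\<^sub>M (\<Pi>\<^sub>M j\<in>UNIV. borel))"
    by (simp add: i response_def inner_axis case_prod_beta)
qed

text \<open>
  \<open>observed_law\<close> is the distribution of the observed vector for any random factors and
  errors, on any probability space, satisfying the assumptions of the model.  Independence of
  factors and errors is written as a product of laws because the library's \<open>indep_var\<close> requires
  both variables to have the same type.
\<close>

lemma (in prob_space) distr_response_eq_observed_law:
  fixes \<eta> :: "'a \<Rightarrow> real ^ ('g::finite option)" and \<epsilon> :: "'j::finite \<Rightarrow> 'a \<Rightarrow> real"
  assumes \<eta>: "distributed M lborel \<eta> (\<lambda>x. ennreal (mvn_density (factor_cov S) x))"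
    and \<epsilon>: "\<And>j. distributed M lborel (\<epsilon> j) (\<lambda>x. ennreal (normal_density 0 (sqrt (l $ j)) x))"
    and indep_\<epsilon>: "indep_vars (\<lambda>_. borel) \<epsilon> UNIV"
    and indep: "distr M (borel \<Otimes>\<^sub>M (\<Pi>\<^sub>M j\<in>UNIV. borel)) (\<lambda>\<omega>. (\<eta> \<omega>, \<lambda>j. \<epsilon> j \<omega>)) =
        distr M borel \<eta> \<Otimes>\<^sub>M distr M (\<Pi>\<^sub>M j\<in>UNIV. borel) (\<lambda>\<omega> j. \<epsilon> j \<omega>)"
  shows "distr M borel (\<lambda>\<omega>. response \<tau> A d (\<eta> \<omega>) (\<lambda>j. \<epsilon> j \<omega>)) = observed_law \<tau> (A, d, S, l)"
proof -
  have m\<eta> [measurable]: "\<eta> \<in> M \<rightarrow>\<^sub>M borel"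
    using \<eta> by (simp add: distributed_def)
  have rv [measurable]: "random_variable borel (\<epsilon> j)" for j
    using indep_\<epsilon> by (auto simp: indep_vars_def)
  have m\<epsilon> [measurable]: "(\<lambda>\<omega> j. \<epsilon> j \<omega>) \<in> M \<rightarrow>\<^sub>M (\<Pi>\<^sub>M j\<in>UNIV. borel)"
    by (rule measurable_PiM_single') auto
  have "distr M borel \<eta> = distr M lborel \<eta>"
    by (rule distr_cong) auto
  then have 1: "distr M borel \<eta> = mvn (factor_cov S)"
    using \<eta> by (simp add: distributed_def mvn_def)
  have 2: "distr M borel (\<epsilon> j) = density lborel (\<lambda>x. ennreal (normal_density 0 (sqrt (l $ j)) x))" for j
  proof -
    have "distr M borel (\<epsilon> j) = distr M lborel (\<epsilon> j)"
      by (rule distr_cong) auto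
    then show ?thesis
      using \<epsilon>[of j] by (simp add: distributed_def)
  qed
  have 3: "distr M (\<Pi>\<^sub>M j\<in>UNIV. borel) (\<lambda>\<omega> j. \<epsilon> j \<omega>) = noise_law l"
    using indep_\<epsilon> indep_vars_iff_distr_eq_PiM[of UNIV \<epsilon> "\<lambda>_. borel"] rv
    by (simp add: 2 noise_law_def restrict_UNIV)
  have 4: "mvn (factor_cov S) \<Otimes>\<^sub>M noise_law l =
      distr M (borel \<Otimes>\<^sub>M (\<Pi>\<^sub>M j\<in>UNIV. borel)) (\<lambda>\<omega>. (\<eta> \<omega>, \<lambda>j. \<epsilon> j \<omega>))"
    using indep by (simp add: 1 3)
  show ?thesis
    unfolding observed_law_def prod.case 4
    by (subst distr_distr[OF measurable_response]) (use m\<eta> m\<epsilon> in \<open>auto simp: comp_def\<close>)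
qed


definition main_testlet :: "real ^ ('g option) ^ 'j \<Rightarrow> 'g::finite \<Rightarrow> real ^ 2 ^ 'j" where
  "main_testlet A g = (\<chi> j. vector [A $ j $ None, A $ j $ Some g])"

text \<open>
  The submatrix of the rows indexed by \<open>B\<close>, padded with zero rows to keep the row type;
  the padding does not affect the (column) rank.
\<close>

definition row_restrict :: "'j set \<Rightarrow> real ^ 'n ^ 'j \<Rightarrow> real ^ 'n ^ 'j" where
  "row_restrict B M = (\<chi> j. if j \<in> B then M $ j else 0)"

lemma rank_row_restrict:
  fixes M :: "real ^ 'n ^ 'j"
  shows "rank (row_restrict B M) = dim ((\<lambda>j. M $ j) ` B)"
proof -
  have "rows (row_restrict B M) - {0} = (\<lambda>j. M $ j) ` B - {0}"
    by (auto simp: rows_def row_def row_restrict_def image_def vec_lambda_eta)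
  then show ?thesis
    unfolding row_rank_def by (metis dim_span span_delete_0)
qed

definition Q_set :: "real ^ ('g option) ^ 'j \<Rightarrow> 'g::finite \<Rightarrow> 'j set" where
  "Q_set A g = {j. A $ j $ Some g \<noteq> 0}"

definition H2_set :: "('j \<Rightarrow> 'g) \<Rightarrow> real ^ ('g option) ^ 'j \<Rightarrow> 'g::finite set" where
  "H2_set \<tau> A = {g. \<exists>B1 B2. testlet \<tau> g = B1 \<union> B2 \<and> B1 \<inter> B2 = {} \<and>
     rank (row_restrict B1 (main_testlet A g)) = 2 \<and>
     rank (row_restrict B2 (main_testlet A g)) = 2}"

definition H3_set :: "('j \<Rightarrow> 'g) \<Rightarrow> real ^ ('g option) ^ 'j \<Rightarrow> 'g::finite set" where
  "H3_set \<tau> A = {g. rank (row_restrict (testlet \<tau> g) (main_testlet A g)) = 2}"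

end

theory Submission
  imports Defs
begin

text \<open>
  The observed law determines its moment generating function, which is that of a normal
  distribution: up to a constant it is the exponential of
  \<open>t \<bullet> d\<close> plus half of a quadratic form in \<open>t\<close>. So the law determines the intercepts, the
  covariances \<open>a i * a j + s g h * (b i * b j)\<close> of distinct items \<open>i\<close> and \<open>j\<close> in testlets \<open>g\<close> and
  \<open>h\<close>, with \<open>s g g = 1\<close>, and the variances of the items (\<open>observed_law_eq_imp_moments_eq\<close>). Here \<open>a\<close> are the main
  and \<open>b\<close> the testlet loadings. The rest is linear algebra in the plane of the rows
  \<open>(a i, b i)\<close>.

  The key is to find one testlet of rank 2 that is aligned, that is, on which any competing model has
  the same main column up to sign. Its testlet column is then determined up to sign by
  the within-testlet covariances, as in a one-factor model with three nonzero loadings. Since the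
  rows of this testlet span the plane, its covariances with the other items determine all main
  loadings, and the other testlets reduce to one-factor models too (\<open>loadings_up_to_sign\<close>). The
  sign convention fixes the signs, and correlations and unique variances can be read off.

  To find an aligned testlet, consider two testlets of rank 2. If their factors are
  correlated, their covariance block has rank 2, and the competing loadings arise from the true ones
  by linear maps \<open>R\<close> of the plane, one for each testlet, which satisfy
  \<open>R g * diag(1, s' g h) * transpose (R h) = diag(1, s g h)\<close>. Within a testlet, \<open>R * transpose R\<close>
  agrees with the identity up to a symmetric matrix that is invisible off the diagonal of the block, and three
  nonzero testlet loadings leave only a very special rank 1 matrix (\<open>off_diagonal_form\<close>). If
  the factors are uncorrelated, the block has rank 1 and determines the main columns up to
  reciprocal scale factors (\<open>uncorrelated_pair\<close>). Three testlets of rank 2 give enough relations to conclude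
  around a triangle (\<open>ex_aligned_if_three_spanning\<close>); with two testlets, a split of one
  of them into two halves of rank 2 provides the missing relation (\<open>aligned_if_splits\<close>).
\<close>

section \<open>Plane configurations\<close>

text \<open>
  Rank 2 of the matrix with rows \<open>(a i, b i)\<close>, \<open>i\<close> in \<open>B\<close>, expressed by its minors.
\<close>

definition plane_spanning :: "('j \<Rightarrow> real) \<Rightarrow> ('j \<Rightarrow> real) \<Rightarrow> 'j set \<Rightarrow> bool" where
  "plane_spanning a b B \<longleftrightarrow> (\<exists>i\<in>B. \<exists>j\<in>B. a i * b j - a j * b i \<noteq> 0)"

lemma plane_spanning_mono: "plane_spanning a b B \<Longrightarrow> B \<subseteq> C \<Longrightarrow> plane_spanning a b C"
  unfolding plane_spanning_def by blast

lemma plane_spanning_kernel: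
  assumes "plane_spanning a b B" and "\<And>i. i \<in> B \<Longrightarrow> x * a i + y * b i = 0"
  shows "x = 0 \<and> y = 0"
proof -
  obtain i j where "i \<in> B" "j \<in> B" "a i * b j - a j * b i \<noteq> 0"
    using assms(1) by (auto simp: plane_spanning_def)
  moreover from this have "x * a i + y * b i = 0" "x * a j + y * b j = 0"
    using assms(2) by auto
  ultimately show ?thesis by algebra
qed

lemma plane_spanning_nonzero:
  assumes "plane_spanning a b B"
  shows "\<exists>i\<in>B. a i \<noteq> 0"
  using plane_spanning_kernel[OF assms, of 1 0] by auto

lemma plane_spanning_bilinear:
  assumes B: "plane_spanning a b B" and C: "plane_spanning c d C"
    and zero: "\<And>i j. i \<in> B \<Longrightarrow> j \<in> C \<Longrightarrow>
      x * (a i * c j) + y * (a i * d j) + z * (b i * c j) + w * (b i * d j) = 0"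
  shows "x = 0 \<and> y = 0 \<and> z = 0 \<and> w = 0"
proof -
  have "x * c j + y * d j = 0 \<and> z * c j + w * d j = 0" if "j \<in> C" for j
  proof (rule plane_spanning_kernel[OF B])
    fix i assume "i \<in> B"
    from zero[OF this that] show "(x * c j + y * d j) * a i + (z * c j + w * d j) * b i = 0"
      by (simp add: algebra_simps)
  qed
  then show ?thesis
    using plane_spanning_kernel[OF C, of x y] plane_spanning_kernel[OF C, of z w] by blast
qed

lemma card_ge_3_avoid:
  assumes "3 \<le> card X"
  obtains j k where "j \<in> X" "k \<in> X" "j \<noteq> k" "j \<noteq> i" "k \<noteq> i"
proof -
  have "card X - 1 \<le> card (X - {i})"
    by (cases "i \<in> X") (simp_all add: card_Diff_singleton)
  then have "2 \<le> card (X - {i})" using assms by simp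
  then obtain Y where "Y \<subseteq> X - {i}" "card Y = 2"
    by (rule obtain_subset_with_card_n)
  then show ?thesis using that unfolding card_2_iff by blast
qed

lemma card_ge_3_distinct:
  assumes "3 \<le> card X"
  obtains i j k where "i \<in> X" "j \<in> X" "k \<in> X" "i \<noteq> j" "i \<noteq> k" "j \<noteq> k"
proof -
  obtain i where "i \<in> X" using assms by (cases "X = {}") auto
  then show ?thesis using card_ge_3_avoid[OF assms, of i] that by metis
qed

text \<open>
  Three nonzero entries are the classical condition for one factor: the products of the three
  give \<open>b i ^ 2 = (b i * b j) * (b i * b k) / (b j * b k)\<close>, and every other entry is
  read off from its product with one of them.
\<close>

lemma eq_up_to_sign_if_products_eq:
  fixes b c :: "'j \<Rightarrow> real"
  assumes prods: "\<And>i j. i \<in> B \<Longrightarrow> j \<in> B \<Longrightarrow> i \<noteq> j \<Longrightarrow> b i * b j = c i * c j"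
    and three: "3 \<le> card {j \<in> B. b j \<noteq> 0}"
  shows "\<exists>e. e\<^sup>2 = 1 \<and> (\<forall>i\<in>B. c i = e * b i)"
proof -
  obtain i j k where ijk: "i \<in> B" "j \<in> B" "k \<in> B" "i \<noteq> j" "i \<noteq> k" "j \<noteq> k"
    and nz: "b i \<noteq> 0" "b j \<noteq> 0" "b k \<noteq> 0"
    by (rule card_ge_3_distinct[OF three]) auto
  have eqs: "b i * b j = c i * c j" "b i * b k = c i * c k" "b j * b k = c j * c k"
    using prods ijk by auto
  define e where "e = c i / b i"
  have ci: "c i = e * b i" using nz by (simp add: e_def)
  have "(c i)\<^sup>2 = (b i)\<^sup>2" using eqs nz by algebra
  then have e: "e\<^sup>2 = 1" using nz by (simp add: e_def power_divide)
  have "c l = e * b l" if l: "l \<in> B" for l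
  proof (cases "l = i")
    case False
    then have "b i * b l = c i * c l" using prods ijk(1) l by auto
    then show ?thesis using e ci nz by algebra
  qed (use ci in simp)
  then show ?thesis using e by blast
qed

text \<open>
  This excludes a competing model in which both loading columns of a testlet are multiples of
  the true main column: the testlet column would satisfy \<open>b i * b j = (c - 1) * (a i * a j)\<close>
  off the diagonal, which forces it to be proportional to the main column.
\<close>

lemma no_rank_one_alternative:
  assumes prods: "\<And>i j. i \<in> B \<Longrightarrow> j \<in> B \<Longrightarrow> i \<noteq> j \<Longrightarrow> a i * a j + b i * b j = c * (a i * a j)"
    and three: "3 \<le> card {j \<in> B. b j \<noteq> 0}"
  shows "\<not> plane_spanning a b B"
proof -
  obtain i j k where ijk: "i \<in> B" "j \<in> B" "k \<in> B" "i \<noteq> j" "i \<noteq> k" "j \<noteq> k"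
    and nz: "b i \<noteq> 0" "b j \<noteq> 0" "b k \<noteq> 0"
    by (rule card_ge_3_distinct[OF three]) auto
  have eqs: "a i * a j + b i * b j = c * (a i * a j)" "a i * a k + b i * b k = c * (a i * a k)"
      "a j * a k + b j * b k = c * (a j * a k)"
    using prods ijk by auto
  have ai: "a i \<noteq> 0" "a j \<noteq> 0" using eqs nz by auto
  have par: "a i * b j = a j * b i"
    using eqs nz by algebra
  have "a i * b l - a l * b i = 0" if l: "l \<in> B" for l
  proof (cases "l = i")
    case False
    then have "a i * a l + b i * b l = c * (a i * a l)" using prods ijk(1) l by auto
    then show ?thesis using eqs par nz ai by algebra
  qed simp
  then have "b i * a l + (- a i) * b l = 0" if "l \<in> B" for l
    using that by (simp add: algebra_simps)
  then show ?thesis using plane_spanning_kernel[of a b B "b i" "- a i"] nz by blast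
qed

text \<open>
  Let \<open>M\<close> be the symmetric matrix with entries \<open>x, y, y, z\<close> and
  \<open>u i = (a i, b i)\<close>. If \<open>M\<close> is nonzero, then \<open>M u i \<noteq> 0\<close> for some \<open>i\<close>, and all
  other items lie on the line orthogonal to \<open>M u i\<close>. This line carries two items with
  nonzero \<open>b\<close> and does not contain \<open>u i\<close>, so \<open>M\<close> annihilates it. Hence \<open>M\<close> is a multiple
  of the square of a vector \<open>(1, f)\<close>, normalised in this way because the line is not the
  first coordinate axis.
\<close>

lemma off_diagonal_form:
  assumes span: "plane_spanning a b B"
    and three: "3 \<le> card {j \<in> B. b j \<noteq> 0}"
    and form: "\<And>i j. i \<in> B \<Longrightarrow> j \<in> B \<Longrightarrow> i \<noteq> j \<Longrightarrow>
      x * (a i * a j) + y * (a i * b j + b i * a j) + z * (b i * b j) = 0"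
  shows "\<exists>f. y = x * f \<and> z = x * f\<^sup>2"
proof (cases "\<forall>i\<in>B. x * a i + y * b i = 0 \<and> y * a i + z * b i = 0")
  case True
  then show ?thesis
    using plane_spanning_kernel[OF span, of x y] plane_spanning_kernel[OF span, of y z] by auto
next
  case False
  then obtain i where i: "i \<in> B" "\<not> (x * a i + y * b i = 0 \<and> y * a i + z * b i = 0)" by auto
  define w1 w2 where "w1 = x * a i + y * b i" and "w2 = y * a i + z * b i"
  have orth: "w1 * a j + w2 * b j = 0" if "j \<in> B" "j \<noteq> i" for j
    using form[OF i(1) that(1)] that(2) by (auto simp: w1_def w2_def algebra_simps)
  obtain j k where jk: "j \<in> B" "k \<in> B" "b j \<noteq> 0" "b k \<noteq> 0" "j \<noteq> k" "j \<noteq> i" "k \<noteq> i"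
    by (rule card_ge_3_avoid[OF three, of i]) auto
  have oj: "w1 * a j + w2 * b j = 0" and ok: "w1 * a k + w2 * b k = 0"
    using orth jk by auto
  have w1: "w1 \<noteq> 0"
    using oj jk(3) i(2) unfolding w1_def[symmetric] w2_def[symmetric] by auto
  have "x * (a j * a k) + y * (a j * b k + b j * a k) + z * (b j * b k) = 0"
    using form jk by auto
  then have vMv: "x * w2\<^sup>2 - 2 * y * w1 * w2 + z * w1\<^sup>2 = 0"
    using oj ok jk(3,4) by algebra
  \<comment> \<open>Otherwise all items would lie on the line orthogonal to \<open>(w1, w2)\<close>.\<close>
  have off: "w1 * a i + w2 * b i \<noteq> 0"
  proof
    assume "w1 * a i + w2 * b i = 0"
    then have "w1 * a l + w2 * b l = 0" if "l \<in> B" for l using orth that by (cases "l = i") auto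
    then show False using plane_spanning_kernel[OF span] w1 by blast
  qed
  \<comment> \<open>The image of the direction vector \<open>(- w2, w1)\<close> of the line is orthogonal to it and to item \<open>i\<close>.\<close>
  have 1: "a i * (y * w1 - x * w2) + b i * (z * w1 - y * w2) = 0"
    by (simp add: w1_def w2_def algebra_simps)
  have 2: "w1 * (z * w1 - y * w2) - w2 * (y * w1 - x * w2) = 0"
    using vMv by (simp add: algebra_simps power2_eq_square)
  have 3: "y * w1 - x * w2 = 0" "z * w1 - y * w2 = 0"
    using 1 2 off by algebra+
  then have "y = x * (w2 / w1) \<and> z = x * (w2 / w1)\<^sup>2"
    using w1 by (simp add: field_simps power2_eq_square)
  then show ?thesis by blast
qed

section \<open>Two models with the same covariances between items\<close>

text \<open>
  Two parameters of the model that give the same covariances between distinct items: \<open>a\<close> and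
  \<open>b\<close> are the main and the testlet loadings and \<open>s\<close> the factor correlations of the first
  one, the primed objects those of the second. The identifiability conditions concern the first
  one only; the loadings of the second are arbitrary. Writing \<open>U g\<close> for the matrix with rows \<open>(a i, b i)\<close>, \<open>i\<close> in
  testlet \<open>g\<close>, the covariances between two testlets are
  \<open>U g * diag(1, s g h) * transpose (U h)\<close>.
\<close>

locale two_bifactor_models =
  fixes \<tau> :: "'j \<Rightarrow> 'g" and a b a' b' :: "'j \<Rightarrow> real" and s s' :: "'g \<Rightarrow> 'g \<Rightarrow> real"
  assumes cov_eq: "\<And>i j. i \<noteq> j \<Longrightarrow>
      a i * a j + s (\<tau> i) (\<tau> j) * (b i * b j) = a' i * a' j + s' (\<tau> i) (\<tau> j) * (b' i * b' j)"
    and diag: "\<And>g. s g g = 1" "\<And>g. s' g g = 1"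
    and sym: "\<And>g h. s g h = s h g"
    and less1: "\<And>g h. g \<noteq> h \<Longrightarrow> (s g h)\<^sup>2 < 1" "\<And>g h. g \<noteq> h \<Longrightarrow> (s' g h)\<^sup>2 < 1"
    and three: "\<And>g. 3 \<le> card {j \<in> \<tau> -` {g}. b j \<noteq> 0}"
begin

abbreviation spans :: "'g \<Rightarrow> bool" where
  "spans g \<equiv> plane_spanning a b (\<tau> -` {g})"

text \<open>
  The primed loadings of testlet \<open>g\<close> are \<open>U g * R\<close> for the matrix \<open>R\<close> with rows \<open>(p, r)\<close>
  and \<open>(q, t)\<close>.
\<close>

definition transforms :: "'g \<Rightarrow> real \<Rightarrow> real \<Rightarrow> real \<Rightarrow> real \<Rightarrow> bool" where
  "transforms g p q r t \<longleftrightarrow>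
     (\<forall>i \<in> \<tau> -` {g}. a' i = p * a i + q * b i \<and> b' i = r * a i + t * b i)"

definition aligned :: "'g \<Rightarrow> bool" where
  "aligned g \<longleftrightarrow> (\<exists>e. e\<^sup>2 = 1 \<and> (\<forall>i \<in> \<tau> -` {g}. a' i = e * a i))"

lemma cov_within:
  "i \<in> \<tau> -` {g} \<Longrightarrow> j \<in> \<tau> -` {g} \<Longrightarrow> i \<noteq> j \<Longrightarrow> a i * a j + b i * b j = a' i * a' j + b' i * b' j"
  using cov_eq[of i j] by (simp add: diag)

lemma cov_between:
  "g \<noteq> h \<Longrightarrow> i \<in> \<tau> -` {g} \<Longrightarrow> j \<in> \<tau> -` {h} \<Longrightarrow>
    a i * a j + s g h * (b i * b j) = a' i * a' j + s' g h * (b' i * b' j)"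
  using cov_eq[of i j] by auto

text \<open>
  For correlated testlet factors the covariance block between the two testlets has rank 2, so
  the two models have the same column space on testlet \<open>g\<close>.
\<close>

lemma transforms_exists:
  assumes gh: "g \<noteq> h" and g: "spans g" and h: "spans h" and nz: "s g h \<noteq> 0"
  shows "s' g h \<noteq> 0" "\<exists>p q r t. transforms g p q r t"
proof -
  obtain k l where kl: "k \<in> \<tau> -` {h}" "l \<in> \<tau> -` {h}" "a k * b l - a l * b k \<noteq> 0"
    using h by (auto simp: plane_spanning_def)
  obtain i j where ij: "i \<in> \<tau> -` {g}" "j \<in> \<tau> -` {g}" "a i * b j - a j * b i \<noteq> 0"
    using g by (auto simp: plane_spanning_def)
  define D where "D = a' k * b' l - a' l * b' k"
  \<comment> \<open>Compare the determinants of the 2 by 2 covariance block of \<open>i, j\<close> against \<open>k, l\<close>.\<close>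
  have "s' g h * ((a' i * b' j - a' j * b' i) * D)
      = s g h * ((a i * b j - a j * b i) * (a k * b l - a l * b k))"
    unfolding D_def
    using cov_between[OF gh ij(1) kl(1)] cov_between[OF gh ij(1) kl(2)]
      cov_between[OF gh ij(2) kl(1)] cov_between[OF gh ij(2) kl(2)]
    by algebra
  then have nz': "s' g h \<noteq> 0" "D \<noteq> 0"
    using nz kl(3) ij(3) by auto
  then show "s' g h \<noteq> 0" by simp
  \<comment> \<open>Cramer's rule, solving the covariances of an item with \<open>k\<close> and \<open>l\<close> for its primed loadings.\<close>
  define p q r t where
    "p = (b' l * a k - b' k * a l) / D" and
    "q = s g h * (b' l * b k - b' k * b l) / D" and
    "r = (a' k * a l - a' l * a k) / (s' g h * D)" and
    "t = s g h * (a' k * b l - a' l * b k) / (s' g h * D)"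
  then have pqrt: "D * p = b' l * a k - b' k * a l" "D * q = s g h * (b' l * b k - b' k * b l)"
      "s' g h * D * r = a' k * a l - a' l * a k" "s' g h * D * t = s g h * (a' k * b l - a' l * b k)"
    using nz' by simp_all
  have "a' m = p * a m + q * b m \<and> b' m = r * a m + t * b m" if m: "m \<in> \<tau> -` {g}" for m
  proof -
    note eqs = cov_between[OF gh m kl(1)] cov_between[OF gh m kl(2)]
    have "D * a' m = (D * p) * a m + (D * q) * b m"
      unfolding pqrt using eqs unfolding D_def by algebra
    moreover have "s' g h * D * b' m = (s' g h * D * r) * a m + (s' g h * D * t) * b m"
      unfolding pqrt using eqs unfolding D_def by algebra
    ultimately have "D * (a' m - (p * a m + q * b m)) = 0"
        "s' g h * D * (b' m - (r * a m + t * b m)) = 0"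
      by (simp_all add: algebra_simps)
    then show ?thesis using nz' by simp
  qed
  then show "\<exists>p q r t. transforms g p q r t" unfolding transforms_def by blast
qed

text \<open>
  In matrix form, \<open>R g * diag(1, s' g h) * transpose (R h) = diag(1, s g h)\<close>; the matrices
  \<open>U g\<close> and \<open>U h\<close> cancel because they have rank 2.
\<close>

lemma transforms_between:
  assumes gh: "g \<noteq> h" and g: "spans g" and h: "spans h"
    and tg: "transforms g p q r t" and th: "transforms h p' q' r' t'"
  shows "p * p' + s' g h * (r * r') = 1" "p * q' + s' g h * (r * t') = 0"
    "q * p' + s' g h * (t * r') = 0" "q * q' + s' g h * (t * t') = s g h"
proof -
  have "p * p' + s' g h * (r * r') - 1 = 0 \<and> p * q' + s' g h * (r * t') = 0 \<and>
    q * p' + s' g h * (t * r') = 0 \<and> q * q' + s' g h * (t * t') - s g h = 0"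
  proof (rule plane_spanning_bilinear[OF g h])
    fix i j assume ij: "i \<in> \<tau> -` {g}" "j \<in> \<tau> -` {h}"
    have "a' i = p * a i + q * b i" "b' i = r * a i + t * b i"
      "a' j = p' * a j + q' * b j" "b' j = r' * a j + t' * b j"
      using tg th ij unfolding transforms_def by blast+
    then show "(p * p' + s' g h * (r * r') - 1) * (a i * a j) + (p * q' + s' g h * (r * t')) * (a i * b j)
       + (q * p' + s' g h * (t * r')) * (b i * a j) + (q * q' + s' g h * (t * t') - s g h) * (b i * b j) = 0"
      using cov_between[OF gh ij] by algebra
  qed
  then show "p * p' + s' g h * (r * r') = 1" "p * q' + s' g h * (r * t') = 0"
    "q * p' + s' g h * (t * r') = 0" "q * q' + s' g h * (t * t') = s g h" by auto
qed

lemma transforms_within_eq: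
  assumes tg: "transforms g p q r t" and ij: "i \<in> \<tau> -` {g}" "j \<in> \<tau> -` {g}" "i \<noteq> j"
  shows "(p\<^sup>2 + r\<^sup>2 - 1) * (a i * a j) + (p * q + r * t) * (a i * b j + b i * a j)
      + (q\<^sup>2 + t\<^sup>2 - 1) * (b i * b j) = 0"
proof -
  have "a' i = p * a i + q * b i" "b' i = r * a i + t * b i"
    "a' j = p * a j + q * b j" "b' j = r * a j + t * b j"
    using tg ij unfolding transforms_def by blast+
  then show ?thesis using cov_within[OF ij] by algebra
qed

text \<open>
  The diagonal of a within-testlet block is blurred by the unique variances, so
  \<open>R * transpose R\<close> need not be the identity matrix. The off-diagonal entries still restrict
  its deviation from the identity to a multiple of the square of a vector \<open>(1, f)\<close>.
\<close>

lemma transforms_within: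
  assumes "spans g" "transforms g p q r t"
  obtains f where "p * q + r * t = (p\<^sup>2 + r\<^sup>2 - 1) * f" "q\<^sup>2 + t\<^sup>2 - 1 = (p\<^sup>2 + r\<^sup>2 - 1) * f\<^sup>2"
  using off_diagonal_form[OF assms(1) three transforms_within_eq[OF assms(2)]] by blast

lemma aligned_if_transforms:
  "transforms g p 0 r t \<Longrightarrow> p\<^sup>2 = 1 \<Longrightarrow> aligned g"
  unfolding transforms_def aligned_def by auto

text \<open>
  Here the covariance block is \<open>a i * a j\<close>, of rank 1. If the primed factors were correlated,
  one of the two testlets would have primed loading columns that are both multiples of the
  column \<open>a\<close>, which the within-testlet covariances exclude. So the primed block is
  \<open>a' i * a' j\<close>, and the main column is determined up to a factor.
\<close>

lemma uncorrelated_pair: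
  assumes gh: "g \<noteq> h" and g: "spans g" and h: "spans h" and z: "s g h = 0"
  obtains c where "c \<noteq> 0" "\<And>i. i \<in> \<tau> -` {g} \<Longrightarrow> a' i = c * a i" "\<And>i. i \<in> \<tau> -` {h} \<Longrightarrow> a' i = a i / c"
proof -
  have cov0: "a i * a j = a' i * a' j + s' g h * (b' i * b' j)"
    if "i \<in> \<tau> -` {g}" "j \<in> \<tau> -` {h}" for i j
    using cov_between[OF gh that] z by simp
  obtain i0 where i0: "i0 \<in> \<tau> -` {g}" "a i0 \<noteq> 0" using plane_spanning_nonzero[OF g] by blast
  obtain j0 where j0: "j0 \<in> \<tau> -` {h}" "a j0 \<noteq> 0" using plane_spanning_nonzero[OF h] by blast
  have no: False if k: "spans k" and m: "\<And>i. i \<in> \<tau> -` {k} \<Longrightarrow> a' i = x * a i \<and> b' i = y * a i" for k x y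
  proof -
    have "a i * a j + b i * b j = (x\<^sup>2 + y\<^sup>2) * (a i * a j)"
      if "i \<in> \<tau> -` {k}" "j \<in> \<tau> -` {k}" "i \<noteq> j" for i j
      using cov_within[OF that] m[OF that(1)] m[OF that(2)] by (simp add: algebra_simps power2_eq_square)
    from no_rank_one_alternative[OF this three] k show False by blast
  qed
  have z': "s' g h = 0"
  proof (rule ccontr)
    assume nz: "s' g h \<noteq> 0"
    show False
    proof (cases "plane_spanning a' b' (\<tau> -` {h})")
      case True
      then obtain k l where kl: "k \<in> \<tau> -` {h}" "l \<in> \<tau> -` {h}" "a' k * b' l - a' l * b' k \<noteq> 0"
        by (auto simp: plane_spanning_def)
      define D where "D = a' k * b' l - a' l * b' k"
      have "a' m = (b' l * a k - b' k * a l) / D * a m \<and>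
          b' m = (a' k * a l - a' l * a k) / (s' g h * D) * a m" if m: "m \<in> \<tau> -` {g}" for m
      proof -
        note eqs = cov0[OF m kl(1)] cov0[OF m kl(2)]
        have "D * a' m = (b' l * a k - b' k * a l) * a m"
          using eqs unfolding D_def by algebra
        moreover have "s' g h * D * b' m = (a' k * a l - a' l * a k) * a m"
          using eqs unfolding D_def by algebra
        ultimately show ?thesis using nz kl(3)[folded D_def] by (simp add: field_simps)
      qed
      then show False by (rule no[OF g])
    next
      case False
      have "a' m = a' j0 / a j0 * a m \<and> b' m = b' j0 / a j0 * a m" if m: "m \<in> \<tau> -` {h}" for m
      proof -
        have "a' m * b' j0 - a' j0 * b' m = 0"
          using False m j0(1) by (auto simp: plane_spanning_def)
        then have "a i0 * (a' m * a j0) = a i0 * (a' j0 * a m)" "a i0 * (b' m * a j0) = a i0 * (b' j0 * a m)"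
          using cov0[OF i0(1) m] cov0[OF i0(1) j0(1)] by algebra+
        then show ?thesis using i0(2) j0(2) by (simp add: field_simps)
      qed
      then show False by (rule no[OF h])
    qed
  qed
  have prod: "a i * a j = a' i * a' j" if "i \<in> \<tau> -` {g}" "j \<in> \<tau> -` {h}" for i j
    using cov0[OF that] z' by simp
  have nz: "a' i0 \<noteq> 0" "a' j0 \<noteq> 0" using prod[OF i0(1) j0(1)] i0 j0 by auto
  show ?thesis
  proof (rule that[of "a j0 / a' j0"])
    show "a j0 / a' j0 \<noteq> 0" using j0 nz by simp
    show "a' i = a j0 / a' j0 * a i" if "i \<in> \<tau> -` {g}" for i
      using prod[OF that j0(1)] nz by (simp add: field_simps)
    show "a' j = a j / (a j0 / a' j0)" if "j \<in> \<tau> -` {h}" for j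
    proof -
      have "a' j * a j0 = a j * a' j0"
        using prod[OF i0(1) that] prod[OF i0(1) j0(1)] nz i0(2) j0(2) by algebra
      then show ?thesis using j0 nz by (simp add: field_simps)
    qed
  qed
qed

lemma scaling_unique:
  assumes "spans g" and "\<And>i. i \<in> \<tau> -` {g} \<Longrightarrow> a' i = c * a i" and "\<And>i. i \<in> \<tau> -` {g} \<Longrightarrow> a' i = d * a i"
  shows "c = d"
  using plane_spanning_nonzero[OF assms(1)] assms(2,3) by fastforce

lemma scaled_transforms:
  assumes "spans g" "transforms g p q r t" and "\<And>i. i \<in> \<tau> -` {g} \<Longrightarrow> a' i = c * a i"
  shows "p = c \<and> q = 0"
proof -
  have "(p - c) * a i + q * b i = 0" if "i \<in> \<tau> -` {g}" for i
    using assms(2,3) that unfolding transforms_def by (fastforce simp: algebra_simps)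
  from plane_spanning_kernel[OF assms(1) this] show ?thesis by auto
qed

text \<open>
  If the main column is only rescaled on \<open>h\<close>, then the matrix relation between \<open>R g\<close> and
  \<open>R h\<close> makes the latter upper and the former lower triangular.
\<close>

lemma scaled_neighbour:
  assumes gh: "g \<noteq> h" and g: "spans g" and h: "spans h" and nz: "s g h \<noteq> 0"
    and tg: "transforms g p q r t" and c: "\<And>i. i \<in> \<tau> -` {h} \<Longrightarrow> a' i = c * a i"
  shows "p * c = 1"
proof -
  obtain p' q' r' t' where th: "transforms h p' q' r' t'"
    using transforms_exists(2)[OF gh[symmetric] h g] nz sym by metis
  have pq: "p' = c" "q' = 0" using scaled_transforms[OF h th c] by auto
  note eqs = transforms_between[OF gh g h tg th, unfolded pq]
  from eqs(4) nz have "s' g h * t' \<noteq> 0" by auto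
  with eqs(2) have "r = 0" by auto
  with eqs(1) show ?thesis by simp
qed

text \<open>
  The next four lemmas go through the numbers of correlated pairs among three spanning testlets.
  In the first three of them, the coefficients with which the main column enters its primed
  version on two testlets are reciprocal, whether the pair is correlated or not; around a
  triangle this makes each of them its own reciprocal.
\<close>

lemma aligned_if_no_pair_correlated:
  assumes "g \<noteq> h" "g \<noteq> k" "h \<noteq> k" and sp: "spans g" "spans h" "spans k"
    and z: "s g h = 0" "s g k = 0" "s h k = 0"
  shows "aligned g"
proof -
  obtain c where c: "c \<noteq> 0" "\<And>i. i \<in> \<tau> -` {g} \<Longrightarrow> a' i = c * a i" "\<And>i. i \<in> \<tau> -` {h} \<Longrightarrow> a' i = 1 / c * a i"
    using uncorrelated_pair[OF assms(1) sp(1,2) z(1)] by (metis mult_1 times_divide_eq_left)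
  obtain d where d: "d \<noteq> 0" "\<And>i. i \<in> \<tau> -` {g} \<Longrightarrow> a' i = d * a i" "\<And>i. i \<in> \<tau> -` {k} \<Longrightarrow> a' i = 1 / d * a i"
    using uncorrelated_pair[OF assms(2) sp(1,3) z(2)] by (metis mult_1 times_divide_eq_left)
  obtain e where e: "e \<noteq> 0" "\<And>i. i \<in> \<tau> -` {h} \<Longrightarrow> a' i = e * a i" "\<And>i. i \<in> \<tau> -` {k} \<Longrightarrow> a' i = 1 / e * a i"
    using uncorrelated_pair[OF assms(3) sp(2,3) z(3)] by (metis mult_1 times_divide_eq_left)
  have eqs: "c = d" "1 / c = e" "1 / d = 1 / e"
    using scaling_unique[OF sp(1) c(2) d(2)] scaling_unique[OF sp(2) c(3) e(2)]
      scaling_unique[OF sp(3) d(3) e(3)] by auto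
  have "c * e = 1" using c(1) eqs(2)[symmetric] by simp
  moreover have "c = e" using eqs(1,3) by simp
  ultimately have "c\<^sup>2 = 1" by (simp add: power2_eq_square)
  then show ?thesis using c(2) unfolding aligned_def by blast
qed

lemma aligned_if_one_pair_correlated:
  assumes "g \<noteq> h" "g \<noteq> k" "h \<noteq> k" and sp: "spans g" "spans h" "spans k"
    and z: "s g h \<noteq> 0" "s g k = 0" "s h k = 0"
  shows "aligned g"
proof -
  obtain d where d: "d \<noteq> 0" "\<And>i. i \<in> \<tau> -` {g} \<Longrightarrow> a' i = d * a i" "\<And>i. i \<in> \<tau> -` {k} \<Longrightarrow> a' i = 1 / d * a i"
    using uncorrelated_pair[OF assms(2) sp(1,3) z(2)] by (metis mult_1 times_divide_eq_left)
  obtain e where e: "e \<noteq> 0" "\<And>i. i \<in> \<tau> -` {h} \<Longrightarrow> a' i = e * a i" "\<And>i. i \<in> \<tau> -` {k} \<Longrightarrow> a' i = 1 / e * a i"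
    using uncorrelated_pair[OF assms(3) sp(2,3) z(3)] by (metis mult_1 times_divide_eq_left)
  obtain p q r t where tg: "transforms g p q r t"
    using transforms_exists(2)[OF assms(1) sp(1,2) z(1)] by blast
  have "p = d" "1 / d = 1 / e" "p * e = 1"
    using scaled_transforms[OF sp(1) tg d(2)] scaling_unique[OF sp(3) d(3) e(3)]
      scaled_neighbour[OF assms(1) sp(1,2) z(1) tg e(2)] by auto
  then have "d\<^sup>2 = 1" by (auto simp: power2_eq_square)
  then show ?thesis using d(2) unfolding aligned_def by blast
qed

lemma aligned_if_two_pairs_correlated:
  assumes "g \<noteq> h" "g \<noteq> k" "h \<noteq> k" and sp: "spans g" "spans h" "spans k"
    and z: "s g h \<noteq> 0" "s g k \<noteq> 0" "s h k = 0"
  shows "aligned h"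
proof -
  obtain e where e: "e \<noteq> 0" "\<And>i. i \<in> \<tau> -` {h} \<Longrightarrow> a' i = e * a i" "\<And>i. i \<in> \<tau> -` {k} \<Longrightarrow> a' i = 1 / e * a i"
    using uncorrelated_pair[OF assms(3) sp(2,3) z(3)] by (metis mult_1 times_divide_eq_left)
  obtain p q r t where tg: "transforms g p q r t"
    using transforms_exists(2)[OF assms(1) sp(1,2) z(1)] by blast
  have "p * e = 1" "p * (1 / e) = 1"
    using scaled_neighbour[OF assms(1) sp(1,2) z(1) tg e(2)]
      scaled_neighbour[OF assms(2) sp(1,3) z(2) tg e(3)] by auto
  then have "e\<^sup>2 = 1" using e(1) by (simp add: power2_eq_square)
  then show ?thesis using e(2) unfolding aligned_def by blast
qed

text \<open>
  Multiplying the relations of the three pairs cyclically, so that the other two transformations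
  cancel, gives \<open>R g * diag(1, x') * transpose (R g) = diag(1, x)\<close> for
  \<open>x = s g h * s g k / s h k\<close>. Subtracting it from \<open>R g * transpose (R g)\<close> shows that a multiple of the
  square of the second column \<open>(r, t)\<close> of \<open>R g\<close> equals \<open>diag(0, 1 - x)\<close> plus a multiple of
  the square of \<open>(1, f)\<close>. For \<open>x \<noteq> 1\<close> this has rank 2 unless the latter multiple
  vanishes, and then \<open>r = 0\<close>.
\<close>

lemma aligned_if_all_pairs_correlated:
  assumes d: "g \<noteq> h" "g \<noteq> k" "h \<noteq> k" and sp: "spans g" "spans h" "spans k"
    and nz: "s g h \<noteq> 0" "s g k \<noteq> 0" "s h k \<noteq> 0"
    and ne: "s g h * s g k \<noteq> s h k"
  shows "aligned g"
proof -
  obtain p q r t where tg: "transforms g p q r t"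
    using transforms_exists(2)[OF d(1) sp(1,2) nz(1)] by blast
  obtain p2 q2 r2 t2 where th: "transforms h p2 q2 r2 t2"
    using transforms_exists(2)[OF d(3) sp(2,3) nz(3)] by blast
  obtain p3 q3 r3 t3 where tk: "transforms k p3 q3 r3 t3"
    using transforms_exists(2)[OF d(3)[symmetric] sp(3,2)] nz(3) sym by metis
  note gh = transforms_between[OF d(1) sp(1,2) tg th]
  note gk = transforms_between[OF d(2) sp(1,3) tg tk]
  note hk = transforms_between[OF d(3) sp(2,3) th tk]
  have nz': "s' h k \<noteq> 0" using transforms_exists(1)[OF d(3) sp(2,3) nz(3)] .
  have inv: "s h k * (p2 * p3) + q2 * q3 = s h k" "s h k * (p2 * r3) + q2 * t3 = 0"
    "s h k * (r2 * p3) + t2 * q3 = 0" "s' h k * (s h k * (r2 * r3) + t2 * t3) = s h k"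
    using hk nz(3) nz' by algebra+
  define x where "x = s g h * s g k / s h k"
  define x' where "x' = s' g h * s' g k / s' h k"
  have x: "s g h * s g k = x * s h k" "x \<noteq> 1" and x': "s' g h * s' g k = x' * s' h k"
    using nz nz' ne by (auto simp: x_def x'_def)
  \<comment> \<open>\<open>inv\<close> says that \<open>transpose (R h) * diag(1, 1 / s h k) * R k = diag(1, 1 / s' h k)\<close>.\<close>
  have product: "u * v + x' * (y * z) = (u * p2 + s' g h * (y * r2)) * (v * p3 + s' g k * (z * r3))
      + (u * q2 + s' g h * (y * t2)) * (v * q3 + s' g k * (z * t3)) / s h k" for u v y z
  proof -
    have "s h k * ((u * p2 + s' g h * (y * r2)) * (v * p3 + s' g k * (z * r3)))
        + (u * q2 + s' g h * (y * t2)) * (v * q3 + s' g k * (z * t3))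
      = u * v * (s h k * (p2 * p3) + q2 * q3)
        + u * z * s' g k * (s h k * (p2 * r3) + q2 * t3)
        + y * v * s' g h * (s h k * (r2 * p3) + t2 * q3)
        + y * z * (s' g h * s' g k) * (s h k * (r2 * r3) + t2 * t3)"
      by (simp add: algebra_simps)
    also have "\<dots> = u * v * s h k + x' * (y * z) * (s' h k * (s h k * (r2 * r3) + t2 * t3))"
      unfolding inv(1-3) x' by (simp add: algebra_simps)
    also have "\<dots> = s h k * (u * v + x' * (y * z))"
      unfolding inv(4) by (simp add: algebra_simps)
    finally show ?thesis using nz(3) by (simp add: field_simps)
  qed
  have 1: "p\<^sup>2 + x' * r\<^sup>2 = 1"
    using product[of p p r r] gh(1,2) gk(1,2) by (simp add: power2_eq_square)
  have 2: "p * q + x' * (r * t) = 0"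
    using product[of p q r t] gh(1,2) gk(3,4) by simp
  have 3: "q\<^sup>2 + x' * t\<^sup>2 = x"
    using product[of q q t t] gh(3,4) gk(3,4) nz(3) by (simp add: power2_eq_square x_def)
  obtain f where f: "p * q + r * t = (p\<^sup>2 + r\<^sup>2 - 1) * f" "q\<^sup>2 + t\<^sup>2 - 1 = (p\<^sup>2 + r\<^sup>2 - 1) * f\<^sup>2"
    by (rule transforms_within[OF sp(1) tg])
  have "r = 0"
  proof (rule ccontr)
    assume r: "r \<noteq> 0"
    have "(1 - x') * r * (t - r * f) = 0" using f(1) 1 2 by algebra
    then have "(1 - x') * (t - r * f) = 0" using r by simp
    then have "(1 - x') * t\<^sup>2 = (1 - x') * r\<^sup>2 * f\<^sup>2" by algebra
    then have "x = 1" using f(2) 1 3 by algebra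
    then show False using x(2) by simp
  qed
  then have "p\<^sup>2 = 1" "q = 0" using 1 2 by (auto simp: power2_eq_square)
  then show ?thesis using aligned_if_transforms tg by blast
qed

text \<open>
  If all three pairs are correlated, the condition \<open>x \<noteq> 1\<close> of the preceding lemma cannot fail at
  two corners of the triangle at once, because then a correlation would have square 1.
\<close>

lemma ex_aligned_if_three_spanning:
  assumes d: "g \<noteq> h" "g \<noteq> k" "h \<noteq> k" and sp: "spans g" "spans h" "spans k"
  shows "\<exists>g. spans g \<and> aligned g"
proof -
  note z = sym[of h g] sym[of k g] sym[of k h]
  note d' = d d[symmetric]
  have three: "\<exists>g. spans g \<and> aligned g" if nz: "s g h \<noteq> 0" "s g k \<noteq> 0" "s h k \<noteq> 0"
  proof (cases "s g h * s g k = s h k")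
    case True
    \<comment> \<open>The condition fails at \<open>g\<close>, so it holds at \<open>h\<close>.\<close>
    have "s h g * s h k \<noteq> s g k"
    proof
      assume "s h g * s h k = s g k"
      then have "(s g h)\<^sup>2 * s g k = s g k" using True z by (simp add: power2_eq_square ac_simps)
      then show False using nz(2) less1(1)[OF d(1)] by simp
    qed
    then show ?thesis using aligned_if_all_pairs_correlated[of h g k] d' sp nz z by auto
  qed (use aligned_if_all_pairs_correlated[OF d sp nz] sp in blast)
  note cases = aligned_if_no_pair_correlated[OF d sp]
    aligned_if_one_pair_correlated[OF d sp] aligned_if_one_pair_correlated[OF d'(2,1,6) sp(1,3,2)] aligned_if_one_pair_correlated[OF d'(3,4,5) sp(2,3,1)]
    aligned_if_two_pairs_correlated[OF d sp] aligned_if_two_pairs_correlated[OF d'(4,3,2) sp(2,1,3)] aligned_if_two_pairs_correlated[OF d'(5,6,1) sp(3,1,2)]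
  show ?thesis
    using three cases[unfolded z] sp by blast
qed

text \<open>
  A split into two spanning halves makes up for the third testlet, since the covariances between
  the halves are not affected by the unique variances. If the factors of \<open>g\<close> and \<open>h\<close> are uncorrelated, the
  primed main column is \<open>c\<close> times the true one, and
  \<open>(1 - c^2) * (a i * a j) + b i * b j = b' i * b' j\<close> between the halves; the right-hand side has
  rank 1, the left-hand side has rank 2 unless \<open>c^2 = 1\<close>. If they are correlated, the halves show
  that \<open>R g\<close> is orthogonal, and the deviation of \<open>R h * transpose (R h)\<close> from the identity
  restricts \<open>R g\<close> to a diagonal matrix.
\<close>

lemma aligned_if_splits:
  assumes gh: "g \<noteq> h" and h: "spans h"
    and split: "B1 \<union> B2 \<subseteq> \<tau> -` {g}" "B1 \<inter> B2 = {}"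
    and B1: "plane_spanning a b B1" and B2: "plane_spanning a b B2"
  shows "aligned g"
proof -
  have g: "spans g" using B1 split(1) plane_spanning_mono by blast
  have pairs: "i \<in> \<tau> -` {g}" "j \<in> \<tau> -` {g}" "i \<noteq> j" if "i \<in> B1" "j \<in> B2" for i j
    using that split by auto
  show ?thesis
  proof (cases "s g h = 0")
    case True
    obtain c where c: "c \<noteq> 0" "\<And>i. i \<in> \<tau> -` {g} \<Longrightarrow> a' i = c * a i"
      using uncorrelated_pair[OF gh g h True] by metis
    obtain i j where ij: "i \<in> B1" "j \<in> B1" "a i * b j - a j * b i \<noteq> 0"
      using B1 by (auto simp: plane_spanning_def)
    obtain k l where kl: "k \<in> B2" "l \<in> B2" "a k * b l - a l * b k \<noteq> 0"
      using B2 by (auto simp: plane_spanning_def)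
    have eq: "(1 - c\<^sup>2) * (a i * a j) + b i * b j = b' i * b' j" if "i \<in> B1" "j \<in> B2" for i j
      using cov_within[OF pairs[OF that]] c(2)[OF pairs(1)[OF that]] c(2)[OF pairs(2)[OF that]]
      by (simp add: algebra_simps power2_eq_square)
    \<comment> \<open>The determinant of the block of \<open>i, j\<close> against \<open>k, l\<close>.\<close>
    have "(1 - c\<^sup>2) * ((a i * b j - a j * b i) * (a k * b l - a l * b k)) = 0"
      using eq[OF ij(1) kl(1)] eq[OF ij(1) kl(2)] eq[OF ij(2) kl(1)] eq[OF ij(2) kl(2)] by algebra
    then have "c\<^sup>2 = 1" using ij(3) kl(3) by simp
    then show ?thesis using c(2) unfolding aligned_def by blast
  next
    case nz: False
    obtain p q r t where tg: "transforms g p q r t"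
      using transforms_exists(2)[OF gh g h nz] by blast
    obtain p2 q2 r2 t2 where th: "transforms h p2 q2 r2 t2"
      using transforms_exists(2)[OF gh[symmetric] h g] nz sym by metis
    note gh_eqs = transforms_between[OF gh g h tg th]
    have nz': "s' g h \<noteq> 0" using transforms_exists(1)[OF gh g h nz] .
    have "p\<^sup>2 + r\<^sup>2 - 1 = 0 \<and> p * q + r * t = 0 \<and> p * q + r * t = 0 \<and> q\<^sup>2 + t\<^sup>2 - 1 = 0"
    proof (rule plane_spanning_bilinear[OF B1 B2])
      fix i j assume "i \<in> B1" "j \<in> B2"
      from transforms_within_eq[OF tg pairs[OF this]]
      show "(p\<^sup>2 + r\<^sup>2 - 1) * (a i * a j) + (p * q + r * t) * (a i * b j)
        + (p * q + r * t) * (b i * a j) + (q\<^sup>2 + t\<^sup>2 - 1) * (b i * b j) = 0"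
        by (simp add: algebra_simps)
    qed
    then have orth: "p\<^sup>2 + r\<^sup>2 = 1" "p * q + r * t = 0" "q\<^sup>2 + t\<^sup>2 = 1" by auto
    obtain f where f: "p2 * q2 + r2 * t2 = (p2\<^sup>2 + r2\<^sup>2 - 1) * f"
        "q2\<^sup>2 + t2\<^sup>2 - 1 = (p2\<^sup>2 + r2\<^sup>2 - 1) * f\<^sup>2"
      by (rule transforms_within[OF h th])
    define x where "x = s g h"
    define x' where "x' = s' g h"
    note gh_eqs = gh_eqs[folded x_def x'_def]
    \<comment> \<open>\<open>R h = diag(1, x) * R g * diag(1, 1 / x')\<close>, as \<open>R g\<close> is its own inverse transpose.\<close>
    have sol: "p2 = p" "q2 = x * q" "x' * r2 = r" "x' * t2 = x * t"
      using gh_eqs orth by algebra+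
    have r: "r = 0"
    proof (rule ccontr)
      assume r: "r \<noteq> 0"
      have sq: "(x' * r2)\<^sup>2 = r\<^sup>2" "(x' * r2) * (x' * t2) = r * (x * t)" "(x' * t2)\<^sup>2 = (x * t)\<^sup>2"
        using sol(3,4) by simp_all
      have orth': "p\<^sup>2 - 1 = - r\<^sup>2" "p * q = - (r * t)" "q\<^sup>2 = 1 - t\<^sup>2"
        using orth by (simp_all add: algebra_simps)
      define m where "m = p2\<^sup>2 + r2\<^sup>2 - 1"
      have m: "x'\<^sup>2 * m = (1 - x'\<^sup>2) * r\<^sup>2"
        using sq(1) orth'(1) unfolding m_def sol(1) by algebra
      have x'1: "1 - x'\<^sup>2 \<noteq> 0" using less1(2)[OF gh] by (simp add: x'_def)
      have "x'\<^sup>2 * (m * f) = x * (1 - x'\<^sup>2) * (r * t)"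
        using sq(2) orth'(2) unfolding f(1)[folded m_def, symmetric] sol(1,2) by algebra
      then have "(1 - x'\<^sup>2) * r * (r * f - x * t) = 0" using m by algebra
      then have rf: "r * f = x * t" using r x'1 by simp
      have "x'\<^sup>2 * (m * f\<^sup>2) = x'\<^sup>2 * (x\<^sup>2 - 1) + x\<^sup>2 * (1 - x'\<^sup>2) * t\<^sup>2"
        using sq(3) orth'(3) unfolding f(2)[folded m_def, symmetric] sol(2) by algebra
      then have "x'\<^sup>2 * (x\<^sup>2 - 1) = 0" using m rf by algebra
      then show False using less1(1)[OF gh] nz' by (simp add: x_def x'_def)
    qed
    then have "p\<^sup>2 = 1" using orth by simp
    moreover have "q = 0" using r orth(2) calculation by auto
    ultimately show ?thesis using aligned_if_transforms tg by blast
  qed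
qed

text \<open>
  One aligned testlet suffices: its testlet column is determined up to sign by the one-factor
  argument, and since it spans the plane, its covariances with any other item determine the main
  loading of that item. What remains in the other testlets are one-factor models.
\<close>

lemma loadings_up_to_sign:
  assumes g: "spans g" and al: "aligned g"
  obtains e where "e\<^sup>2 = 1" "\<And>i. a' i = e * a i"
    "\<And>h. \<exists>c. c\<^sup>2 = 1 \<and> (\<forall>i \<in> \<tau> -` {h}. b' i = c * b i)"
proof -
  obtain e where e: "e\<^sup>2 = 1" and a_g: "\<And>i. i \<in> \<tau> -` {g} \<Longrightarrow> a' i = e * a i"
    using al unfolding aligned_def by blast
  have b_h: "\<exists>c. c\<^sup>2 = 1 \<and> (\<forall>i \<in> \<tau> -` {h}. b' i = c * b i)"
    if a_h: "\<And>i. i \<in> \<tau> -` {h} \<Longrightarrow> a' i = e * a i" for h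
  proof (rule eq_up_to_sign_if_products_eq[OF _ three])
    fix i j assume ij: "i \<in> \<tau> -` {h}" "j \<in> \<tau> -` {h}" "i \<noteq> j"
    have "a' i * a' j = e\<^sup>2 * (a i * a j)"
      using a_h[OF ij(1)] a_h[OF ij(2)] by (simp add: power2_eq_square)
    then show "b i * b j = b' i * b' j"
      using cov_within[OF ij] e by simp
  qed
  obtain c where c: "c\<^sup>2 = 1" and b_g: "\<And>i. i \<in> \<tau> -` {g} \<Longrightarrow> b' i = c * b i"
    using b_h[of g] a_g by blast
  have a_all: "a' j = e * a j" for j
  proof (cases "\<tau> j = g")
    case False
    then have gj: "g \<noteq> \<tau> j" "j \<in> \<tau> -` {\<tau> j}" by auto
    have "(a j - e * a' j) * a i + (s g (\<tau> j) * b j - s' g (\<tau> j) * c * b' j) * b i = 0"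
      if i: "i \<in> \<tau> -` {g}" for i
      using cov_between[OF gj(1) i gj(2)] a_g[OF i] b_g[OF i] by (simp add: algebra_simps)
    from plane_spanning_kernel[OF g this] have "a j = e * a' j" by simp
    then have "e * a j = e\<^sup>2 * a' j" by (simp add: power2_eq_square)
    then show ?thesis using e by simp
  qed (use a_g in simp)
  show ?thesis by (rule that[OF e a_all b_h]) (rule a_all)
qed

end

section \<open>Moment generating functions of normal distributions\<close>

lemma sym_pos_def_symmetric:
  assumes "sym_pos_def S"
  shows "x \<bullet> (S *v y) = y \<bullet> (S *v x)"
proof -
  have "x v* S = S *v x"
    using assms transpose_matrix_vector[of S x] by (simp add: sym_pos_def_def)
  then show ?thesis
    by (metis dot_lmul_matrix inner_commute)
qed

lemma sym_pos_def_invertible: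
  assumes "sym_pos_def S"
  shows "S ** matrix_inv S = mat 1"
proof -
  have "\<forall>x. S *v x = 0 \<longrightarrow> x = 0"
    using assms by (metis sym_pos_def_def inner_zero_right less_irrefl)
  then have "invertible S"
    by (simp add: invertible_left_inverse matrix_left_invertible_ker)
  then show ?thesis
    unfolding invertible_def matrix_inv_def by (rule someI2_ex) auto
qed

text \<open>
  The determinant does not vanish on the segment from the identity to \<open>S\<close>, all of whose matrices
  are positive definite.
\<close>

lemma sym_pos_def_det_pos:
  fixes S :: "real ^ 'n ^ 'n"
  assumes "sym_pos_def S"
  shows "det S > 0"
proof (rule ccontr)
  define f where "f t = det (\<chi> i j. (1 - t) * mat 1 $ i $ j + t * S $ i $ j)" for t :: real
  have f01: "f 0 = 1" "f 1 = det S"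
    by (simp_all add: f_def vec_lambda_eta)
  assume "\<not> det S > 0"
  moreover have "continuous_on {0..1} f"
    unfolding f_def det_def by (intro continuous_intros)
  ultimately obtain t where t: "0 \<le> t" "t \<le> 1" "f t = 0"
    using IVT2'[of f 1 0 0] f01 by auto
  define M where "M = (\<chi> i j. (1 - t) * mat 1 $ i $ j + t * S $ i $ j)"
  have "M *v x = (1 - t) *\<^sub>R x + t *\<^sub>R (S *v x)" for x
  proof -
    have "M = (1 - t) *\<^sub>R mat 1 + t *\<^sub>R S" by (simp add: M_def vec_eq_iff)
    then show ?thesis by (simp add: matrix_vector_mult_add_rdistrib scaleR_matrix_vector_assoc[symmetric])
  qed
  then have quad: "x \<bullet> (M *v x) = (1 - t) * (x \<bullet> x) + t * (x \<bullet> (S *v x))" for x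
    by (simp add: inner_add_right)
  have "x \<bullet> (M *v x) > 0" if "x \<noteq> 0" for x
  proof (cases "t = 0")
    case True
    then show ?thesis using that by (simp add: quad)
  next
    case False
    have "x \<bullet> (S *v x) > 0" using assms that by (simp add: sym_pos_def_def)
    then have "t * (x \<bullet> (S *v x)) > 0" using False t by simp
    moreover have "(1 - t) * (x \<bullet> x) \<ge> 0" using t by simp
    ultimately show ?thesis unfolding quad by simp
  qed
  then have "\<forall>x. M *v x = 0 \<longrightarrow> x = 0"
    by (metis inner_zero_right less_irrefl)
  then have "invertible M"
    by (simp add: invertible_left_inverse matrix_left_invertible_ker)
  then show False
    using t(3) unfolding invertible_det_nz f_def M_def by simp
qed

text \<open>
  The constant is the minimum of the quadratic form on the unit sphere. It bounds the normal
  density by a product of univariate Gaussian functions, which makes its integral finite.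
\<close>

lemma matrix_inv_coercive:
  fixes S :: "real ^ 'n ^ 'n"
  assumes S: "sym_pos_def S"
  obtains c where "c > 0" "\<And>x. c * (x \<bullet> x) \<le> x \<bullet> (matrix_inv S *v x)"
proof -
  let ?q = "\<lambda>x. x \<bullet> (matrix_inv S *v x)"
  have pos: "?q x > 0" if "x \<noteq> 0" for x
  proof -
    have Sx: "S *v (matrix_inv S *v x) = x"
      by (simp add: matrix_vector_mul_assoc sym_pos_def_invertible[OF S])
    then have "matrix_inv S *v x \<noteq> 0" using that by auto
    then have "(matrix_inv S *v x) \<bullet> (S *v (matrix_inv S *v x)) > 0"
      using S unfolding sym_pos_def_def by blast
    then show ?thesis by (simp add: Sx inner_commute)
  qed
  have "continuous_on (sphere 0 1) ?q"
    by (intro continuous_intros)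
  moreover have "(axis undefined 1 :: real ^ 'n) \<in> sphere 0 1"
    by (simp add: dist_norm)
  ultimately obtain x0 where x0: "x0 \<in> sphere 0 1" "\<And>y. y \<in> sphere 0 1 \<Longrightarrow> ?q x0 \<le> ?q y"
    using continuous_attains_inf[of "sphere 0 1" ?q] compact_sphere by (metis empty_iff)
  show ?thesis
  proof (rule that[of "?q x0"])
    show "?q x0 > 0" using pos[of x0] x0(1) by (cases "x0 = 0") auto
    show "?q x0 * (x \<bullet> x) \<le> ?q x" for x
    proof (cases "x = 0")
      case False
      define u where "u = (1 / norm x) *\<^sub>R x"
      have xu: "x = norm x *\<^sub>R u" using False by (simp add: u_def)
      have "u \<in> sphere 0 1" using False by (simp add: u_def)
      then have "?q x0 \<le> ?q u" by (rule x0(2))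
      moreover have "?q x = (norm x)\<^sup>2 * ?q u"
        by (subst (1 2) xu) (simp add: matrix_vector_mult_scaleR power2_eq_square)
      ultimately show ?thesis
        by (simp add: power2_norm_eq_inner mult_left_mono mult.commute)
    qed simp
  qed
qed

lemma nn_integral_gaussian_finite:
  assumes "c > 0"
  shows "(\<integral>\<^sup>+ x. ennreal (exp (- (c * (x \<bullet> x)) / 2)) \<partial>(lborel :: 'a::euclidean_space measure)) < \<infinity>"
proof -
  define s where "s = 1 / sqrt c"
  have s: "s > 0" "s\<^sup>2 = 1 / c" using assms by (simp_all add: s_def power_divide)
  have one: "(\<integral>\<^sup>+ y. ennreal (exp (- (c * y\<^sup>2) / 2)) \<partial>lborel) < \<infinity>"
  proof -
    have "ennreal (exp (- (c * y\<^sup>2) / 2)) = ennreal (sqrt (2 * pi * s\<^sup>2)) * ennreal (normal_density 0 s y)" for y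
      using s assms
      by (simp add: normal_density_def ennreal_mult[symmetric] field_simps)
    moreover have "(\<integral>\<^sup>+ y. ennreal (normal_density 0 s y) \<partial>lborel) = 1"
      using prob_space.emeasure_space_1[OF prob_space_normal_density[of s 0]] s
      by (simp add: emeasure_density)
    ultimately show ?thesis by (simp add: nn_integral_cmult ennreal_mult_less_top)
  qed
  have "(\<integral>\<^sup>+ x. ennreal (exp (- (c * (x \<bullet> x)) / 2)) \<partial>(lborel :: 'a measure))
      = (\<integral>\<^sup>+ x. (\<Prod>b\<in>Basis. ennreal (exp (- (c * (x \<bullet> b)\<^sup>2) / 2))) \<partial>(lborel :: 'a measure))"
  proof (intro nn_integral_cong)
    fix x :: 'a
    have "x \<bullet> x = (\<Sum>b\<in>Basis. (x \<bullet> b)\<^sup>2)"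
      by (subst euclidean_inner) (simp add: power2_eq_square)
    then have "- (c * (x \<bullet> x)) / 2 = (\<Sum>b\<in>Basis. - (c * (x \<bullet> b)\<^sup>2) / 2)"
      by (simp add: sum_distrib_left sum_negf sum_divide_distrib)
    then show "ennreal (exp (- (c * (x \<bullet> x)) / 2)) = (\<Prod>b\<in>Basis. ennreal (exp (- (c * (x \<bullet> b)\<^sup>2) / 2)))"
      by (simp add: exp_sum prod_ennreal)
  qed
  also have "\<dots> = (\<Prod>b\<in>(Basis :: 'a set). \<integral>\<^sup>+ y. ennreal (exp (- (c * y\<^sup>2) / 2)) \<partial>lborel)"
    by (rule nn_integral_lborel_prod) auto
  also have "\<dots> < \<infinity>"
    using one by (simp add: power_less_top_ennreal)
  finally show ?thesis .
qed

lemma measurable_mvn_density [measurable]: "mvn_density S \<in> borel_measurable borel"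
proof -
  have [measurable]: "(\<lambda>x. x \<bullet> (matrix_inv S *v x)) \<in> borel_measurable borel"
    by (intro borel_measurable_continuous_onI continuous_intros)
  show ?thesis unfolding mvn_density_def by measurable
qed

lemma mvn_density_pos:
  assumes "sym_pos_def S"
  shows "mvn_density S x > 0"
  using sym_pos_def_det_pos[OF assms] by (simp add: mvn_density_def)

text \<open>
  That the total mass is finite and nonzero suffices for cancelling it when two moment generating
  functions are compared.
\<close>

lemma mvn_total_mass:
  fixes S :: "real ^ 'n ^ 'n"
  assumes S: "sym_pos_def S"
  shows "emeasure (mvn S) UNIV \<noteq> 0" "emeasure (mvn S) UNIV < \<infinity>"
proof -
  have mass: "emeasure (mvn S) UNIV = (\<integral>\<^sup>+ x. ennreal (mvn_density S x) \<partial>lborel)"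
    by (simp add: mvn_def emeasure_density)
  show "emeasure (mvn S) UNIV \<noteq> 0"
  proof
    assume "emeasure (mvn S) UNIV = 0"
    then have "AE x in (lborel :: (real ^ 'n) measure). ennreal (mvn_density S x) = 0"
      unfolding mass by (subst (asm) nn_integral_0_iff_AE) auto
    then have "AE x in (lborel :: (real ^ 'n) measure). False"
      using mvn_density_pos[OF S] by (simp add: ennreal_eq_0_iff less_le_not_le)
    then show False by (simp add: eventually_False ae_filter_eq_bot_iff)
  qed
  obtain c where c: "c > 0" "\<And>x. c * (x \<bullet> x) \<le> x \<bullet> (matrix_inv S *v x)"
    using matrix_inv_coercive[OF S] by blast
  let ?N = "sqrt ((2 * pi) ^ CARD('n) * det S)"
  have N: "?N > 0" using sym_pos_def_det_pos[OF S] by simp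
  have "(\<integral>\<^sup>+ x. ennreal (mvn_density S x) \<partial>lborel)
      \<le> (\<integral>\<^sup>+ x. ennreal (1 / ?N) * ennreal (exp (- (c * (x \<bullet> x)) / 2)) \<partial>(lborel :: (real ^ 'n) measure))"
  proof (intro nn_integral_mono)
    fix x :: "real ^ 'n"
    have "exp (- (x \<bullet> (matrix_inv S *v x)) / 2) \<le> exp (- (c * (x \<bullet> x)) / 2)" using c(2)[of x] by simp
    then have "mvn_density S x \<le> 1 / ?N * exp (- (c * (x \<bullet> x)) / 2)"
      using N by (simp add: mvn_density_def divide_right_mono)
    then show "ennreal (mvn_density S x) \<le> ennreal (1 / ?N) * ennreal (exp (- (c * (x \<bullet> x)) / 2))"
      using N by (subst ennreal_mult[symmetric]) (auto intro: ennreal_leI)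
  qed
  also have "\<dots> < \<infinity>"
    using nn_integral_gaussian_finite[OF c(1), where 'a = "real ^ 'n"]
    by (subst nn_integral_cmult) (auto simp: ennreal_mult_less_top)
  finally show "emeasure (mvn S) UNIV < \<infinity>" by (simp add: mass)
qed

lemma nn_integral_lborel_shift:
  fixes f :: "'a::euclidean_space \<Rightarrow> ennreal"
  assumes [measurable]: "f \<in> borel_measurable borel"
  shows "(\<integral>\<^sup>+ x. f (x - c) \<partial>lborel) = (\<integral>\<^sup>+ x. f x \<partial>lborel)"
proof -
  have "(\<integral>\<^sup>+ x. f x \<partial>lborel) = (\<integral>\<^sup>+ x. f x \<partial>distr lborel borel ((+) (- c)))"
    by (simp add: lborel_distr_plus)
  also have "\<dots> = (\<integral>\<^sup>+ x. f (x - c) \<partial>lborel)"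
    by (subst nn_integral_distr) auto
  finally show ?thesis ..
qed

text \<open>
  Completing the square turns the integrand into a multiple of the density shifted by
  \<open>S *v v\<close>, and Lebesgue measure is translation invariant.
\<close>

lemma nn_integral_exp_mvn:
  fixes S :: "real ^ 'n ^ 'n"
  assumes S: "sym_pos_def S"
  shows "(\<integral>\<^sup>+ x. ennreal (exp (v \<bullet> x)) \<partial>mvn S)
    = ennreal (exp (v \<bullet> (S *v v) / 2)) * emeasure (mvn S) UNIV"
proof -
  define c where "c = S *v v"
  have Sinv: "S *v (matrix_inv S *v x) = x" for x
    by (simp add: matrix_vector_mul_assoc sym_pos_def_invertible[OF S])
  have "matrix_inv S ** S = mat 1"
    using sym_pos_def_invertible[OF S] matrix_left_right_inverse by blast
  then have invS: "matrix_inv S *v c = v"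
    by (simp add: c_def matrix_vector_mul_assoc)
  have cx: "c \<bullet> (matrix_inv S *v x) = v \<bullet> x" for x
    using sym_pos_def_symmetric[OF S, of "matrix_inv S *v x" v]
    by (simp add: c_def Sinv inner_commute)
  have square: "mvn_density S x * exp (v \<bullet> x) = exp (v \<bullet> c / 2) * mvn_density S (x - c)" for x
  proof -
    have "(x - c) \<bullet> (matrix_inv S *v (x - c)) = x \<bullet> (matrix_inv S *v x) - 2 * (v \<bullet> x) + v \<bullet> c"
      by (simp add: matrix_vector_mult_diff_distrib inner_diff_left inner_diff_right invS cx inner_commute)
    then have "v \<bullet> c / 2 + - ((x - c) \<bullet> (matrix_inv S *v (x - c))) / 2
        = v \<bullet> x + - (x \<bullet> (matrix_inv S *v x)) / 2"
      by (simp add: field_simps)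
    then have "exp (v \<bullet> c / 2) * exp (- ((x - c) \<bullet> (matrix_inv S *v (x - c))) / 2)
        = exp (v \<bullet> x) * exp (- (x \<bullet> (matrix_inv S *v x)) / 2)"
      by (simp flip: exp_add)
    then show ?thesis by (simp add: mvn_density_def mult.commute)
  qed
  note pos = less_imp_le[OF mvn_density_pos[OF S]]
  have "(\<integral>\<^sup>+ x. ennreal (exp (v \<bullet> x)) \<partial>mvn S)
      = (\<integral>\<^sup>+ x. ennreal (mvn_density S x) * ennreal (exp (v \<bullet> x)) \<partial>lborel)"
    unfolding mvn_def by (subst nn_integral_density) auto
  also have "\<dots> = (\<integral>\<^sup>+ x. ennreal (exp (v \<bullet> c / 2)) * ennreal (mvn_density S (x - c)) \<partial>lborel)"
    by (intro nn_integral_cong) (simp add: ennreal_mult[symmetric] pos square)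
  also have "\<dots> = ennreal (exp (v \<bullet> c / 2)) * (\<integral>\<^sup>+ x. ennreal (mvn_density S (x - c)) \<partial>lborel)"
    by (subst nn_integral_cmult) auto
  also have "(\<integral>\<^sup>+ x. ennreal (mvn_density S (x - c)) \<partial>lborel) = emeasure (mvn S) UNIV"
    by (subst nn_integral_lborel_shift[of "\<lambda>x. ennreal (mvn_density S x)"])
       (auto simp: mvn_def emeasure_density)
  finally show ?thesis by (simp add: c_def)
qed

lemma nn_integral_exp_normal:
  assumes "\<sigma> > 0"
  shows "(\<integral>\<^sup>+ x. ennreal (exp (t * x)) \<partial>density lborel (\<lambda>x. ennreal (normal_density 0 \<sigma> x)))
    = ennreal (exp (t\<^sup>2 * \<sigma>\<^sup>2 / 2))"
proof -
  have "exp (t * x) * normal_density 0 \<sigma> x = exp (t\<^sup>2 * \<sigma>\<^sup>2 / 2) * normal_density (t * \<sigma>\<^sup>2) \<sigma> x" for x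
  proof -
    have "t * x + - x\<^sup>2 / (2 * \<sigma>\<^sup>2) = t\<^sup>2 * \<sigma>\<^sup>2 / 2 + - (x - t * \<sigma>\<^sup>2)\<^sup>2 / (2 * \<sigma>\<^sup>2)"
      using assms by (simp add: field_simps power2_eq_square)
    then have "exp (t * x) * exp (- x\<^sup>2 / (2 * \<sigma>\<^sup>2)) = exp (t\<^sup>2 * \<sigma>\<^sup>2 / 2) * exp (- (x - t * \<sigma>\<^sup>2)\<^sup>2 / (2 * \<sigma>\<^sup>2))"
      by (simp flip: exp_add)
    then show ?thesis by (simp add: normal_density_def)
  qed
  then have "(\<integral>\<^sup>+ x. ennreal (exp (t * x)) \<partial>density lborel (\<lambda>x. ennreal (normal_density 0 \<sigma> x)))
      = (\<integral>\<^sup>+ x. ennreal (exp (t\<^sup>2 * \<sigma>\<^sup>2 / 2)) * ennreal (normal_density (t * \<sigma>\<^sup>2) \<sigma> x) \<partial>lborel)"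
    by (subst nn_integral_density)
       (auto intro!: nn_integral_cong simp: ennreal_mult[symmetric] mult.commute)
  also have "\<dots> = ennreal (exp (t\<^sup>2 * \<sigma>\<^sup>2 / 2)) * (\<integral>\<^sup>+ x. ennreal (normal_density (t * \<sigma>\<^sup>2) \<sigma> x) \<partial>lborel)"
    by (subst nn_integral_cmult) auto
  also have "(\<integral>\<^sup>+ x. ennreal (normal_density (t * \<sigma>\<^sup>2) \<sigma> x) \<partial>lborel) = 1"
    using prob_space.emeasure_space_1[OF prob_space_normal_density[OF assms, of "t * \<sigma>\<^sup>2"]]
    by (simp add: emeasure_density)
  finally show ?thesis by simp
qed

lemma prob_space_noise_law:
  assumes "\<And>j. l $ j > 0"
  shows "prob_space (noise_law l)"
  unfolding noise_law_def using assms by (intro prob_space_PiM prob_space_normal_density) simp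

lemma nn_integral_exp_noise_law:
  fixes l t :: "real ^ 'j"
  assumes l: "\<And>j. l $ j > 0"
  shows "(\<integral>\<^sup>+ \<epsilon>. ennreal (exp (\<Sum>j\<in>UNIV. t $ j * \<epsilon> j)) \<partial>noise_law l)
    = ennreal (exp ((\<Sum>j\<in>UNIV. (t $ j)\<^sup>2 * l $ j) / 2))"
proof -
  let ?M = "\<lambda>j. density lborel (\<lambda>x. ennreal (normal_density 0 (sqrt (l $ j)) x))"
  have "prob_space (?M j)" for j
    using l by (intro prob_space_normal_density) simp
  then interpret product_sigma_finite ?M
    by (simp add: product_sigma_finite_def prob_space_imp_sigma_finite)
  have "(\<integral>\<^sup>+ \<epsilon>. ennreal (exp (\<Sum>j\<in>UNIV. t $ j * \<epsilon> j)) \<partial>noise_law l)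
      = (\<integral>\<^sup>+ \<epsilon>. (\<Prod>j\<in>UNIV. ennreal (exp (t $ j * \<epsilon> j))) \<partial>noise_law l)"
    by (simp add: exp_sum prod_ennreal)
  also have "\<dots> = (\<Prod>j\<in>UNIV. \<integral>\<^sup>+ x. ennreal (exp (t $ j * x)) \<partial>?M j)"
    unfolding noise_law_def by (rule product_nn_integral_prod) auto
  also have "\<dots> = (\<Prod>j\<in>UNIV. ennreal (exp ((t $ j)\<^sup>2 * l $ j / 2)))"
  proof (rule prod.cong)
    fix j
    show "(\<integral>\<^sup>+ x. ennreal (exp (t $ j * x)) \<partial>?M j) = ennreal (exp ((t $ j)\<^sup>2 * l $ j / 2))"
      using nn_integral_exp_normal[of "sqrt (l $ j)" "t $ j"] l[of j] by simp
  qed simp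
  also have "\<dots> = ennreal (exp ((\<Sum>j\<in>UNIV. (t $ j)\<^sup>2 * l $ j) / 2))"
    by (simp add: prod_ennreal exp_sum[symmetric] sum_divide_distrib)
  finally show ?thesis .
qed

section \<open>Moments of the observed law\<close>

lemma inner_factor_cov:
  "x \<bullet> (factor_cov S *v y)
    = x $ None * y $ None + (\<chi> g. x $ Some g) \<bullet> (S *v (\<chi> g. y $ Some g))"
  by (simp add: inner_vec_def matrix_vector_mult_def factor_cov_def UNIV_option_conv sum.reindex)

lemma inner_axis_matrix_axis:
  fixes S :: "real ^ 'n ^ 'n"
  shows "axis g x \<bullet> (S *v axis h y) = S $ g $ h * (x * y)"
proof -
  have "(S *v axis h y) $ g = S $ g $ h * y"
    by (simp add: matrix_vector_mult_def axis_def if_distrib cong: if_cong)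
  then show ?thesis by (simp add: inner_axis')
qed

lemma sym_pos_def_nth_commute:
  assumes "sym_pos_def S"
  shows "S $ g $ h = S $ h $ g"
proof -
  have "transpose S $ h $ g = S $ g $ h" by (simp add: transpose_def)
  then show ?thesis using assms by (simp add: sym_pos_def_def)
qed

lemma sym_pos_def_factor_cov:
  assumes "sym_pos_def S"
  shows "sym_pos_def (factor_cov S)"
  unfolding sym_pos_def_def
proof (intro conjI allI impI)
  note commute = sym_pos_def_nth_commute[OF assms]
  show "transpose (factor_cov S) = factor_cov S"
    by (simp add: transpose_def factor_cov_def vec_eq_iff commute split: option.split)
next
  fix x :: "real ^ 'a option" assume "x \<noteq> 0"
  define y where "y = (\<chi> g. x $ Some g)"
  have quad: "x \<bullet> (factor_cov S *v x) = (x $ None)\<^sup>2 + y \<bullet> (S *v y)"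
    by (simp add: inner_factor_cov y_def power2_eq_square)
  show "x \<bullet> (factor_cov S *v x) > 0"
  proof (cases "y = 0")
    case True
    then have "x $ Some g = 0" for g by (metis y_def vec_lambda_beta zero_index)
    then have "x $ None \<noteq> 0" using \<open>x \<noteq> 0\<close>
      by (metis not_None_eq vec_eq_iff zero_index)
    then show ?thesis using True by (simp add: quad)
  next
    case False
    then have "y \<bullet> (S *v y) > 0" using assms by (simp add: sym_pos_def_def)
    then show ?thesis unfolding quad by (simp add: add_nonneg_pos)
  qed
qed

text \<open>
  Evaluate the quadratic form at \<open>e_g - c e_h\<close>, where \<open>c\<close> is the entry.
\<close>

lemma correlation_less_one:
  fixes S :: "real ^ 'n ^ 'n"
  assumes S: "sym_pos_def S" and diag: "\<And>g. S $ g $ g = 1" and gh: "g \<noteq> h"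
  shows "(S $ g $ h)\<^sup>2 < 1"
proof -
  define c where "c = S $ g $ h"
  have sym: "S $ h $ g = c"
    unfolding c_def by (rule sym_pos_def_nth_commute[OF S])
  define x :: "real ^ 'n" where "x = axis g 1 - axis h c"
  have "x $ g = 1" using gh by (simp add: x_def axis_def)
  then have "x \<noteq> 0" by auto
  then have "x \<bullet> (S *v x) > 0" using S by (simp add: sym_pos_def_def)
  also have "x \<bullet> (S *v x) = 1 - c\<^sup>2"
    unfolding x_def
    by (simp add: matrix_vector_mult_diff_distrib inner_diff_left inner_diff_right inner_axis_matrix_axis
        diag sym c_def[symmetric] power2_eq_square)
  finally show ?thesis by (simp add: c_def)
qed

text \<open>
  The variance of the linear combination of the responses with coefficients \<open>t\<close>.
\<close>

definition response_variance :: "('j::finite, 'g::finite) params \<Rightarrow> real ^ 'j \<Rightarrow> real" where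
  "response_variance = (\<lambda>(A, d, S, l) t.
     (t v* A) \<bullet> (factor_cov S *v (t v* A)) + (\<Sum>j\<in>UNIV. (t $ j)\<^sup>2 * l $ j))"

lemma inner_response:
  fixes \<tau> :: "'j::finite \<Rightarrow> 'g::finite"
  assumes A: "\<And>j g. g \<noteq> \<tau> j \<Longrightarrow> A $ j $ Some g = 0"
  shows "t \<bullet> response \<tau> A d \<eta> \<epsilon> = t \<bullet> d + (t v* A) \<bullet> \<eta> + (\<Sum>j\<in>UNIV. t $ j * \<epsilon> j)"
proof -
  have "(A *v \<eta>) $ j = A $ j $ None * \<eta> $ None + A $ j $ Some (\<tau> j) * \<eta> $ Some (\<tau> j)" for j
  proof -
    have "(\<Sum>g\<in>UNIV. A $ j $ Some g * \<eta> $ Some g)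
        = (\<Sum>g\<in>UNIV. if g = \<tau> j then A $ j $ Some (\<tau> j) * \<eta> $ Some (\<tau> j) else 0)"
      by (rule sum.cong) (auto simp: A)
    then show ?thesis
      by (simp add: matrix_vector_mult_def UNIV_option_conv sum.reindex)
  qed
  then have "response \<tau> A d \<eta> \<epsilon> = d + A *v \<eta> + (\<chi> j. \<epsilon> j)"
    by (simp add: response_def vec_eq_iff)
  moreover have "t \<bullet> (\<chi> j. \<epsilon> j) = (\<Sum>j\<in>UNIV. t $ j * \<epsilon> j)"
    by (simp add: inner_vec_def)
  ultimately show ?thesis
    by (simp add: inner_add_right dot_lmul_matrix)
qed

lemma nn_integral_exp_observed_law:
  fixes \<tau> :: "'j::{finite,linorder} \<Rightarrow> 'g::finite"
  assumes P: "(A, d, S, l) \<in> param_space \<tau>"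
  shows "(\<integral>\<^sup>+ y. ennreal (exp (t \<bullet> y)) \<partial>observed_law \<tau> (A, d, S, l))
    = ennreal (exp (t \<bullet> d + response_variance (A, d, S, l) t / 2)) * emeasure (mvn (factor_cov S)) UNIV"
proof -
  have A: "A $ j $ Some g = 0" if "g \<noteq> \<tau> j" for j g
    using P that by (auto simp: param_space_def)
  have S: "sym_pos_def (factor_cov S)" and l: "\<And>j. l $ j > 0"
    using P by (auto simp: param_space_def intro: sym_pos_def_factor_cov)
  define v where "v = t v* A"
  let ?E = "mvn (factor_cov S)" and ?N = "noise_law l"
  interpret N: prob_space ?N by (rule prob_space_noise_law[OF l])
  have setsE: "sets ?E = sets borel" by (simp add: mvn_def)
  have sets: "sets (?E \<Otimes>\<^sub>M ?N) = sets (borel \<Otimes>\<^sub>M (\<Pi>\<^sub>M j\<in>UNIV. borel))"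
    by (intro sets_pair_measure_cong setsE sets_noise_law)
  have meas: "(\<lambda>(\<eta>, \<epsilon>). response \<tau> A d \<eta> \<epsilon>) \<in> ?E \<Otimes>\<^sub>M ?N \<rightarrow>\<^sub>M borel"
    using measurable_response measurable_cong_sets[OF sets refl] by blast
  have "(\<integral>\<^sup>+ y. ennreal (exp (t \<bullet> y)) \<partial>observed_law \<tau> (A, d, S, l))
      = (\<integral>\<^sup>+ \<omega>. ennreal (exp (t \<bullet> (case \<omega> of (\<eta>, \<epsilon>) \<Rightarrow> response \<tau> A d \<eta> \<epsilon>))) \<partial>(?E \<Otimes>\<^sub>M ?N))"
    unfolding observed_law_def prod.case by (subst nn_integral_distr[OF meas]) auto
  also have "\<dots> = (\<integral>\<^sup>+ \<eta>. \<integral>\<^sup>+ \<epsilon>. ennreal (exp (t \<bullet> response \<tau> A d \<eta> \<epsilon>)) \<partial>?N \<partial>?E)"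
    by (subst N.nn_integral_fst[symmetric]) (use meas in auto)
  also have "\<dots> = (\<integral>\<^sup>+ \<eta>. \<integral>\<^sup>+ \<epsilon>. ennreal (exp (t \<bullet> d) * exp (v \<bullet> \<eta>)) *
      ennreal (exp (\<Sum>j\<in>UNIV. t $ j * \<epsilon> j)) \<partial>?N \<partial>?E)"
    by (simp add: inner_response[OF A] v_def exp_add ennreal_mult[symmetric])
  also have "\<dots> = (\<integral>\<^sup>+ \<eta>. ennreal (exp (t \<bullet> d) * exp (v \<bullet> \<eta>)) *
      ennreal (exp ((\<Sum>j\<in>UNIV. (t $ j)\<^sup>2 * l $ j) / 2)) \<partial>?E)"
  proof (intro nn_integral_cong)
    fix \<eta>
    have [measurable]: "(\<lambda>\<epsilon> :: 'j \<Rightarrow> real. \<epsilon> j) \<in> borel_measurable ?N" for j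
      unfolding measurable_cong_sets[OF sets_noise_law refl] by (rule measurable_component_singleton) simp
    show "(\<integral>\<^sup>+ \<epsilon>. ennreal (exp (t \<bullet> d) * exp (v \<bullet> \<eta>)) * ennreal (exp (\<Sum>j\<in>UNIV. t $ j * \<epsilon> j)) \<partial>?N)
      = ennreal (exp (t \<bullet> d) * exp (v \<bullet> \<eta>)) * ennreal (exp ((\<Sum>j\<in>UNIV. (t $ j)\<^sup>2 * l $ j) / 2))"
      by (subst nn_integral_cmult) (auto simp: nn_integral_exp_noise_law[OF l])
  qed
  also have "\<dots> = (\<integral>\<^sup>+ \<eta>. ennreal (exp (t \<bullet> d + (\<Sum>j\<in>UNIV. (t $ j)\<^sup>2 * l $ j) / 2)) * ennreal (exp (v \<bullet> \<eta>)) \<partial>?E)"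
    by (intro nn_integral_cong) (simp add: ennreal_mult[symmetric] exp_add mult_ac)
  also have "\<dots> = ennreal (exp (t \<bullet> d + (\<Sum>j\<in>UNIV. (t $ j)\<^sup>2 * l $ j) / 2)) * (\<integral>\<^sup>+ \<eta>. ennreal (exp (v \<bullet> \<eta>)) \<partial>?E)"
    by (subst nn_integral_cmult) (auto simp: measurable_cong_sets[OF setsE refl])
  also have "\<dots> = ennreal (exp (t \<bullet> d + response_variance (A, d, S, l) t / 2)) * emeasure ?E UNIV"
    unfolding nn_integral_exp_mvn[OF S]
    by (simp add: response_variance_def v_def[symmetric] mult.assoc[symmetric] ennreal_mult[symmetric]
        exp_add[symmetric] add_divide_distrib add_ac)
  finally show ?thesis .
qed

text \<open>
  The moment generating functions at 0 identify the total masses. After cancelling them, the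
  exponents agree, and so do their odd and even parts in \<open>t\<close>.
\<close>

lemma observed_law_eq_imp_moments_eq:
  fixes \<tau> :: "'j::{finite,linorder} \<Rightarrow> 'g::finite"
  assumes P: "(A, d, S, l) \<in> param_space \<tau>" and P': "(A', d', S', l') \<in> param_space \<tau>"
    and eq: "observed_law \<tau> (A', d', S', l') = observed_law \<tau> (A, d, S, l)"
  shows "d' = d" "response_variance (A', d', S', l') t = response_variance (A, d, S, l) t"
proof -
  let ?r = "response_variance (A, d, S, l)" and ?r' = "response_variance (A', d', S', l')"
  let ?Z = "emeasure (mvn (factor_cov S)) UNIV" and ?Z' = "emeasure (mvn (factor_cov S')) UNIV"
  have mgf: "ennreal (exp (t \<bullet> d' + ?r' t / 2)) * ?Z' = ennreal (exp (t \<bullet> d + ?r t / 2)) * ?Z" for t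
    using nn_integral_exp_observed_law[OF P, of t] nn_integral_exp_observed_law[OF P', of t] eq by simp
  have "sym_pos_def (factor_cov S)"
    using P by (auto simp: param_space_def intro: sym_pos_def_factor_cov)
  note Z = mvn_total_mass[OF this]
  have ZZ: "?Z' = ?Z"
    using mgf[of 0] by (simp add: response_variance_def)
  obtain z where z: "?Z = ennreal z" "z > 0"
    using Z by (cases ?Z) (auto simp: less_le)
  have ex: "t \<bullet> d' + ?r' t / 2 = t \<bullet> d + ?r t / 2" for t
    using mgf[of t] z by (simp add: ZZ ennreal_mult[symmetric])
  have even: "?r (- t) = ?r t" "?r' (- t) = ?r' t" for t
  proof -
    have "(- t) v* M = - (t v* M)" for M :: "real ^ 'g option ^ 'j::{finite,linorder}"
      by (simp add: vector_matrix_mult_def vec_eq_iff sum_negf)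
    then show "?r (- t) = ?r t" "?r' (- t) = ?r' t"
      by (simp_all add: response_variance_def inner_factor_cov matrix_vector_mult_def inner_vec_def sum_negf)
  qed
  have both: "t \<bullet> d' = t \<bullet> d \<and> ?r' t = ?r t" for t
    using ex[of t] ex[of "- t"] by (simp add: even)
  then show "?r' t = ?r t" by blast
  show "d' = d" using both vector_eq_ldot by blast
qed

lemma axis_vector_matrix:
  fixes A :: "real ^ 'n ^ 'm"
  shows "axis i 1 v* A = A $ i"
  by (simp add: vector_matrix_mult_def vec_eq_iff axis_def if_distrib if_distribR cong: if_cong)

lemma response_variance_axis:
  "response_variance (A, d, S, l) (axis i 1) = A $ i \<bullet> (factor_cov S *v A $ i) + l $ i"
proof -
  have "(\<Sum>j\<in>UNIV. (axis i 1 $ j)\<^sup>2 * l $ j) = (\<Sum>j\<in>UNIV. if j = i then l $ i else 0)"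
    by (rule sum.cong) (auto simp: axis_def)
  then show ?thesis by (simp add: response_variance_def axis_vector_matrix)
qed

lemma response_variance_axis_add:
  assumes "i \<noteq> j" and S: "sym_pos_def S"
  shows "response_variance (A, d, S, l) (axis i 1 + axis j 1) =
    response_variance (A, d, S, l) (axis i 1) + response_variance (A, d, S, l) (axis j 1)
      + 2 * (A $ i \<bullet> (factor_cov S *v A $ j))"
proof -
  have "(axis i 1 + axis j 1) v* A = A $ i + A $ j"
    by (simp add: vector_matrix_left_distrib axis_vector_matrix)
  moreover have "(\<Sum>k\<in>UNIV. ((axis i 1 + axis j 1) $ k)\<^sup>2 * l $ k)
      = (\<Sum>k\<in>UNIV. (axis i 1 $ k)\<^sup>2 * l $ k) + (\<Sum>k\<in>UNIV. (axis j 1 $ k)\<^sup>2 * l $ k)"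
    unfolding sum.distrib[symmetric] using \<open>i \<noteq> j\<close> by (intro sum.cong) (auto simp: axis_def)
  moreover have "A $ j \<bullet> (factor_cov S *v A $ i) = A $ i \<bullet> (factor_cov S *v A $ j)"
    by (rule sym_pos_def_symmetric[OF sym_pos_def_factor_cov[OF S]])
  ultimately show ?thesis
    by (simp add: response_variance_def axis_vector_matrix matrix_vector_right_distrib
        inner_add_left inner_add_right)
qed

lemma inner_rows_factor_cov:
  assumes A: "\<And>j g. g \<noteq> \<tau> j \<Longrightarrow> A $ j $ Some g = 0"
  shows "A $ i \<bullet> (factor_cov S *v A $ j) = A $ i $ None * A $ j $ None
    + S $ \<tau> i $ \<tau> j * (A $ i $ Some (\<tau> i) * A $ j $ Some (\<tau> j))"
proof -
  have "(\<chi> g. A $ j $ Some g) = axis (\<tau> j) (A $ j $ Some (\<tau> j))" for j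
    using A by (auto simp: vec_eq_iff axis_def)
  then show ?thesis by (simp add: inner_factor_cov inner_axis_matrix_axis)
qed

section \<open>Identifiability\<close>

lemma plane_spanning_if_rank_2:
  assumes "rank (row_restrict B (main_testlet A g)) = 2"
  shows "plane_spanning (\<lambda>j. A $ j $ None) (\<lambda>j. A $ j $ Some g) B"
proof (rule ccontr)
  let ?u = "\<lambda>j. main_testlet A g $ j"
  assume "\<not> ?thesis"
  then have par: "A $ i $ None * A $ j $ Some g = A $ j $ None * A $ i $ Some g" if "i \<in> B" "j \<in> B" for i j
    using that by (auto simp: plane_spanning_def)
  have comp: "?u j $ 1 = A $ j $ None" "?u j $ 2 = A $ j $ Some g" for j
    by (simp_all add: main_testlet_def)
  have "\<exists>w. ?u ` B \<subseteq> span {w}"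
  proof (cases "\<forall>i\<in>B. ?u i = 0")
    case True
    then show ?thesis by (auto intro!: exI[of _ 0])
  next
    case False
    then obtain i where i: "i \<in> B" "?u i \<noteq> 0" by blast
    have "?u j \<in> span {?u i}" if j: "j \<in> B" for j
    proof -
      have "\<exists>c. ?u j = c *\<^sub>R ?u i"
      proof (cases "?u i $ 1 = 0")
        case True
        then have "?u i $ 2 \<noteq> 0" using i(2) by (auto simp: vec_eq_iff forall_2)
        then have "?u j = (?u j $ 2 / ?u i $ 2) *\<^sub>R ?u i"
          using par[OF i(1) j] True by (auto simp: vec_eq_iff forall_2 comp)
        then show ?thesis by blast
      next
        case False
        then have "?u j = (?u j $ 1 / ?u i $ 1) *\<^sub>R ?u i"
          using par[OF i(1) j] by (auto simp: vec_eq_iff forall_2 comp field_simps)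
        then show ?thesis by blast
      qed
      then show ?thesis by (auto simp: span_singleton)
    qed
    then show ?thesis by blast
  qed
  then obtain w where "?u ` B \<subseteq> span {w}" by blast
  then have "dim (?u ` B) \<le> dim {w}" by (metis dim_span dim_subset)
  also have "\<dots> \<le> card {w}" by (rule dim_le_card') simp
  finally show False using assms by (simp add: rank_row_restrict)
qed

text \<open>
  The sign convention at the first nonzero entry. The functions \<open>x\<close> and \<open>y\<close> vanish outside
  \<open>B\<close>, as the testlet columns do outside their testlet.
\<close>

lemma sign_eq_one:
  fixes x y :: "'j::{finite,linorder} \<Rightarrow> real"
  assumes e: "e\<^sup>2 = 1" and y: "\<And>j. j \<in> B \<Longrightarrow> y j = e * x j" and nz: "j0 \<in> B" "x j0 \<noteq> 0"
    and out: "\<And>j. j \<notin> B \<Longrightarrow> x j = 0 \<and> y j = 0"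
    and x_pos: "\<And>j. x j \<noteq> 0 \<Longrightarrow> (\<And>i. i < j \<Longrightarrow> x i = 0) \<Longrightarrow> x j > 0"
    and y_pos: "\<And>j. y j \<noteq> 0 \<Longrightarrow> (\<And>i. i < j \<Longrightarrow> y i = 0) \<Longrightarrow> y j > 0"
  shows "e = 1"
proof -
  define j where "j = Min {j. x j \<noteq> 0}"
  have j: "x j \<noteq> 0" using Min_in[of "{j. x j \<noteq> 0}"] nz by (auto simp: j_def)
  have before: "x i = 0" if "i < j" for i
  proof (rule ccontr)
    assume "x i \<noteq> 0"
    then have "j \<le> i" unfolding j_def by (intro Min_le) auto
    then show False using that by simp
  qed
  have jB: "j \<in> B" using out j by blast
  have "x j > 0" using x_pos j before by blast
  moreover have "y j > 0"
  proof (rule y_pos)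
    show "y j \<noteq> 0" using y[OF jB] j e by auto
    show "y i = 0" if "i < j" for i using y[of i] out[of i] before[OF that] by (cases "i \<in> B") auto
  qed
  ultimately have "e > 0" using y[OF jB] by (simp add: zero_less_mult_iff)
  then show ?thesis using e by (auto simp: power2_eq_1_iff)
qed

lemma param_space_column_sign:
  assumes "(A, d, S, l) \<in> param_space \<tau>" "A $ j $ k \<noteq> 0" "\<And>i. i < j \<Longrightarrow> A $ i $ k = 0"
  shows "A $ j $ k > 0"
  using assms unfolding param_space_def by blast

text \<open>
  In the case of two testlets of rank 2, one of them differs from the testlet that splits and
  serves as its partner.
\<close>

lemma ex_aligned_testlet:
  fixes \<tau> :: "'j::finite \<Rightarrow> 'g::finite"
  assumes model: "two_bifactor_models \<tau> (\<lambda>j. A $ j $ None) (\<lambda>j. A $ j $ Some (\<tau> j)) a' b' s s'"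
    and cond: "card (H3_set \<tau> A) \<ge> 3 \<or> card (H3_set \<tau> A) = 2 \<and> card (H2_set \<tau> A) \<ge> 1"
  shows "\<exists>g. plane_spanning (\<lambda>j. A $ j $ None) (\<lambda>j. A $ j $ Some (\<tau> j)) (\<tau> -` {g})
    \<and> two_bifactor_models.aligned \<tau> (\<lambda>j. A $ j $ None) a' g"
proof -
  let ?a = "\<lambda>j. A $ j $ None" and ?b = "\<lambda>j. A $ j $ Some (\<tau> j)"
  interpret two_bifactor_models \<tau> ?a ?b a' b' s s' by (rule model)
  have span_part: "plane_spanning ?a ?b B"
    if "rank (row_restrict B (main_testlet A g)) = 2" "B \<subseteq> \<tau> -` {g}" for g B
  proof -
    have "?b j = A $ j $ Some g" if "j \<in> B" for j
      using that \<open>B \<subseteq> \<tau> -` {g}\<close> by auto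
    then show ?thesis
      using plane_spanning_if_rank_2[OF that(1)] by (simp add: plane_spanning_def)
  qed
  have testlet: "testlet \<tau> g = \<tau> -` {g}" for g by (auto simp: testlet_def)
  have H3: "spans g" if "g \<in> H3_set \<tau> A" for g
    using that by (intro span_part[of _ g]) (simp_all add: H3_set_def testlet)
  from cond show ?thesis
  proof
    assume "card (H3_set \<tau> A) \<ge> 3"
    then obtain g h k where "g \<in> H3_set \<tau> A" "h \<in> H3_set \<tau> A" "k \<in> H3_set \<tau> A"
      "g \<noteq> h" "g \<noteq> k" "h \<noteq> k" by (rule card_ge_3_distinct)
    then show ?thesis using ex_aligned_if_three_spanning[of g h k] H3 by blast
  next
    assume *: "card (H3_set \<tau> A) = 2 \<and> card (H2_set \<tau> A) \<ge> 1"
    then obtain g where "g \<in> H2_set \<tau> A" by (cases "H2_set \<tau> A = {}") auto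
    then obtain B1 B2 where B: "\<tau> -` {g} = B1 \<union> B2" "B1 \<inter> B2 = {}"
      "rank (row_restrict B1 (main_testlet A g)) = 2" "rank (row_restrict B2 (main_testlet A g)) = 2"
      unfolding H2_set_def testlet by blast
    have sp: "plane_spanning ?a ?b B1" "plane_spanning ?a ?b B2"
      using span_part[OF B(3)] span_part[OF B(4)] B(1) by auto
    obtain h where h: "h \<in> H3_set \<tau> A" "g \<noteq> h"
      using * unfolding card_2_iff by blast
    have "aligned g"
      using aligned_if_splits[OF h(2) H3[OF h(1)] _ B(2) sp] B(1) by blast
    moreover have "spans g" using sp(1) B(1) plane_spanning_mono by blast
    ultimately show ?thesis by blast
  qed
qed

theorem theorem2:
  fixes \<tau> :: "'j::{finite,linorder} \<Rightarrow> 'g::finite"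
    and A :: "real ^ ('g option) ^ 'j::{finite,linorder}"
    and d :: "real ^ 'j::{finite,linorder}"
    and S :: "real ^ 'g ^ 'g"
    and l :: "real ^ 'j::{finite,linorder}"
  assumes "surj \<tau>"
    and "(A, d, S, l) \<in> param_space \<tau>"
    and "((\<forall>g. card (Q_set A g) \<ge> 3) \<and> card (H3_set \<tau> A) \<ge> 3) \<or>
         ((\<forall>g. card (Q_set A g) \<ge> 3) \<and> card (H3_set \<tau> A) = 2 \<and> card (H2_set \<tau> A) \<ge> 1)"
  shows "identifiable_at \<tau> (A, d, S, l)"
  unfolding identifiable_at_def
proof (intro ballI impI)
  fix P' assume "P' \<in> param_space \<tau>" and law: "observed_law \<tau> P' = observed_law \<tau> (A, d, S, l)"
  then obtain A' d' S' l' where P'_eq: "P' = (A', d', S', l')" and P': "(A', d', S', l') \<in> param_space \<tau>"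
    by (cases P') auto
  note P = assms(2)
  have Q: "\<And>g. card (Q_set A g) \<ge> 3" and cond: "card (H3_set \<tau> A) \<ge> 3 \<or> card (H3_set \<tau> A) = 2 \<and> card (H2_set \<tau> A) \<ge> 1"
    using assms(3) by auto
  note moments = observed_law_eq_imp_moments_eq[OF P P' law[unfolded P'_eq]]
  have A: "A $ j $ Some g = 0" and A': "A' $ j $ Some g = 0" if "g \<noteq> \<tau> j" for j g
    using P P' that by (auto simp: param_space_def)
  have S: "sym_pos_def S" "\<And>g. S $ g $ g = 1" and S': "sym_pos_def S'" "\<And>g. S' $ g $ g = 1"
    using P P' by (auto simp: param_space_def)
  define a b a' b' where "a j = A $ j $ None" and "b j = A $ j $ Some (\<tau> j)"
    and "a' j = A' $ j $ None" and "b' j = A' $ j $ Some (\<tau> j)" for j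
  note ab = a_def b_def a'_def b'_def
  have var: "a i * a i + b i * b i + l $ i = a' i * a' i + b' i * b' i + l' $ i" for i
    using moments(2)[of "axis i 1"]
    by (simp add: response_variance_axis inner_rows_factor_cov[OF A] inner_rows_factor_cov[OF A'] S S' ab)
  have cov: "a i * a j + S $ \<tau> i $ \<tau> j * (b i * b j) = a' i * a' j + S' $ \<tau> i $ \<tau> j * (b' i * b' j)"
    if "i \<noteq> j" for i j
    using moments(2)[of "axis i 1"] moments(2)[of "axis j 1"] moments(2)[of "axis i 1 + axis j 1"]
      response_variance_axis_add[OF that S(1), of A d l] response_variance_axis_add[OF that S'(1), of A' d' l']
    by (simp add: inner_rows_factor_cov[OF A] inner_rows_factor_cov[OF A'] ab)
  have "A $ j $ Some g \<noteq> 0 \<longleftrightarrow> \<tau> j = g \<and> b j \<noteq> 0" for j g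
    using A[of g j] by (cases "\<tau> j = g") (auto simp: b_def)
  then have Q_eq: "Q_set A g = {j \<in> \<tau> -` {g}. b j \<noteq> 0}" for g
    by (auto simp: Q_set_def)
  interpret two_bifactor_models \<tau> a b a' b' "\<lambda>g h. S $ g $ h" "\<lambda>g h. S' $ g $ h"
    using cov S S' Q correlation_less_one[of S] correlation_less_one[of S']
      sym_pos_def_nth_commute[OF S(1)]
    by unfold_locales (auto simp: Q_eq)
  have funs: "a = (\<lambda>j. A $ j $ None)" "b = (\<lambda>j. A $ j $ Some (\<tau> j))" by (auto simp: ab)
  obtain g0 where g0: "spans g0" "aligned g0"
    using ex_aligned_testlet[OF two_bifactor_models_axioms[unfolded funs] cond, folded funs] by blast
  obtain e where e: "e\<^sup>2 = 1" "\<And>i. a' i = e * a i"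
    and b_sign: "\<And>h. \<exists>c. c\<^sup>2 = 1 \<and> (\<forall>i \<in> \<tau> -` {h}. b' i = c * b i)"
    by (rule loadings_up_to_sign[OF g0]) blast
  obtain i0 where i0: "a i0 \<noteq> 0" using plane_spanning_nonzero[OF g0(1)] by blast
  have "e = 1"
  proof (rule sign_eq_one[OF e(1), of UNIV a' a i0])
    show "0 < a j" if "a j \<noteq> 0" "\<And>i. i < j \<Longrightarrow> a i = 0" for j
      using param_space_column_sign[OF P, of j None] that by (simp add: ab)
    show "0 < a' j" if "a' j \<noteq> 0" "\<And>i. i < j \<Longrightarrow> a' i = 0" for j
      using param_space_column_sign[OF P', of j None] that by (simp add: ab)
  qed (use e i0 in auto)
  then have a_eq: "a' i = a i" for i using e(2) by simp
  have Q_ne: "\<exists>i. \<tau> i = g \<and> b i \<noteq> 0" for g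
  proof -
    have "{j \<in> \<tau> -` {g}. b j \<noteq> 0} \<noteq> {}"
      using Q[of g] unfolding Q_eq by (metis card.empty not_numeral_le_zero)
    then show ?thesis by blast
  qed
  have b_eq: "b' i = b i" for i
  proof -
    obtain c where c: "c\<^sup>2 = 1" "\<And>j. j \<in> \<tau> -` {\<tau> i} \<Longrightarrow> b' j = c * b j" using b_sign by blast
    obtain j0 where j0: "\<tau> j0 = \<tau> i" "b j0 \<noteq> 0" using Q_ne by blast
    have "c = 1"
    proof (rule sign_eq_one[OF c(1), of "\<tau> -` {\<tau> i}" "\<lambda>j. A' $ j $ Some (\<tau> i)" "\<lambda>j. A $ j $ Some (\<tau> i)" j0])
      show "A' $ j $ Some (\<tau> i) = c * A $ j $ Some (\<tau> i)" if "j \<in> \<tau> -` {\<tau> i}" for j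
        using c(2)[OF that] that by (simp add: ab)
      show "A $ j $ Some (\<tau> i) = 0 \<and> A' $ j $ Some (\<tau> i) = 0" if "j \<notin> \<tau> -` {\<tau> i}" for j
        using that A A' by auto
    qed (use j0 param_space_column_sign[OF P] param_space_column_sign[OF P'] in \<open>auto simp: ab\<close>)
    then show ?thesis using c(2)[of i] by simp
  qed
  have "A' = A"
  proof -
    have "A' $ j $ k = A $ j $ k" for j k
    proof (cases k)
      case None
      then show ?thesis using a_eq[of j] by (simp add: ab)
    next
      case (Some g)
      then show ?thesis using b_eq[of j] A[of g j] A'[of g j] by (cases "g = \<tau> j") (simp_all add: ab)
    qed
    then show ?thesis by (simp add: vec_eq_iff)
  qed
  moreover have "S' = S"
  proof -
    have "S' $ g $ h = S $ g $ h" for g h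
    proof (cases "g = h")
      case False
      obtain i j where ij: "\<tau> i = g" "b i \<noteq> 0" "\<tau> j = h" "b j \<noteq> 0" using Q_ne by metis
      then have "i \<noteq> j" using False by blast
      then show ?thesis using cov[of i j] ij by (simp add: a_eq b_eq)
    qed (simp add: S S')
    then show ?thesis by (simp add: vec_eq_iff)
  qed
  moreover have "l' = l" using var by (simp add: a_eq b_eq vec_eq_iff)
  ultimately show "P' = (A, d, S, l)" using moments(1) by (simp add: P'_eq)
qed

end
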